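(* Let $G$ be a compact Lie group with Lie algebra $\mathfrak g$ and suppose $G$ is non-abelian. Then for any $i=1,\dots,7$ the complex structure $I_i$ does not preserve the tangent space of $\mathcal N_{\mathbb O}$ (i.e. it is not true that $I_i(T_X\mathcal N_{\mathbb O})\subset T_X\mathcal N_{\mathbb O}$ for all $X\in\mathcal N_{\mathbb O}$), and $I_i$ cannot be reduced to an almost complex structure on $\mathcal M_{\mathbb O}$ (i.e. it is not true that $I_i$ maps the space $T_{[X]}\mathcal M_{\mathbb O}$ described in the context into itself for all $X\in\mathcal N_{\mathbb O}$).
   Context: Let $f_{ijk}$ ($1\le i,j,k\le 7$) be the totally antisymmetric octonion structure constants with $f_{123}=f_{145}=f_{167}=f_{246}=1$, $f_{257}=f_{347}=f_{356}=-1$, all others not obtained by permuting indices being $0$. The octonions have basis $e_0=1,e_1,\dots,e_7$ with $e_ie_j=-\delta_{ij}e_0+\sum_kf_{ijk}e_k$ for $i,j\ge1$. Let $V$ be the space of ($C^1$) maps $[0,1]\to\mathfrak g\otimes\mathbb R^8$, with $\mathbb R^8$ identified with the octonions. For $i=1,\dots,7$, $I_i$ is the complex structure on (each tangent space of) $V$ induced by left multiplication by $e_i$ on $\mathbb R^8$; e.g. $I_1(Y_0,\dots,Y_7)=(-Y_1,Y_0,-Y_3,Y_2,-Y_5,Y_4,-Y_7,Y_6)$. $\mathcal N_{\mathbb O}\subset V$ is the set of $X=(X_0,\dots,X_7)$ with $$\frac{dX_k}{dt}+[X_0,X_k]+\frac12\sum_{j,l=1}^7f_{kjl}[X_j,X_l]=0,\qquad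 k=1,\dots,7,$$ and $T_X\mathcal N_{\mathbb O}$ is the space of $Y=(Y_0,\dots,Y_7)\in V$ with $$\frac{dY_k}{dt}+[X_0,Y_k]+[Y_0,X_k]+\frac12\sum_{j,l=1}^7f_{kjl}([X_j,Y_l]+[Y_j,X_l])=0,\qquad k=1,\dots,7.$$ $\mathcal M_{\mathbb O}=\mathcal N_{\mathbb O}/\mathcal G_0$, where $\mathcal G_0$ is the group of $C^2$ maps $g:[0,1]\to G$ with $g(0)=g(1)=1$ acting by $X_0\mapsto gX_0g^{-1}-\frac{dg}{dt}g^{-1}$, $X_k\mapsto gX_kg^{-1}$. The tangent space $T_{[X]}\mathcal M_{\mathbb O}$ is identified with the space of $Y\in T_X\mathcal N_{\mathbb O}$ satisfying in addition $\frac{dY_0}{dt}+\sum_{k=0}^7[X_k,Y_k]=0$.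
   Formalization: "G is non-abelian" is read as: the identity component of G is non-abelian (the same thing for connected G); for a disconnected non-abelian G with abelian Lie algebra, such as O(2), the claim about the tangent space of M_O is false. *)

theory Defs
  imports "HOL-Analysis.Analysis" "HOL-Algebra.Group"
begin

section \<open>Smooth maps between Euclidean spaces\<close>

text \<open>\<open>C^k\<close> on an open set, with higher derivatives taken as iterated directional derivatives
  so that the type of the function does not change in the recursion.\<close>

primrec Ck_on :: "nat \<Rightarrow> 'a::euclidean_space set \<Rightarrow> ('a \<Rightarrow> 'b::euclidean_space) \<Rightarrow> bool" where
  "Ck_on 0 S f \<longleftrightarrow> continuous_on S f"
| "Ck_on (Suc k) S f \<longleftrightarrow>
     (\<forall>x\<in>S. f differentiable (at x)) \<and> (\<forall>v. Ck_on k S (\<lambda>x. frechet_derivative f (at x) v))"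

definition smooth_on :: "'a::euclidean_space set \<Rightarrow> ('a \<Rightarrow> 'b::euclidean_space) \<Rightarrow> bool" where
  "smooth_on S f \<longleftrightarrow> (\<forall>k. Ck_on k S f)"

section \<open>Lie groups and their Lie algebras\<close>

text \<open>A chart is a pair \<open>(U, \<phi>)\<close>; only the values of \<open>\<phi>\<close> on \<open>U\<close> matter. Manifolds are modelled
  on an arbitrary Euclidean space \<open>'e\<close>, which has positive dimension (zero-dimensional Lie groups
  have trivial identity component).\<close>

type_synonym ('g, 'e) chart = "'g set \<times> ('g \<Rightarrow> 'e)"

definition is_chart :: "'g topology \<Rightarrow> ('g, 'e::euclidean_space) chart \<Rightarrow> bool" where
  "is_chart T c \<longleftrightarrow> (case c of (U, \<phi>) \<Rightarrow>
     openin T U \<and> open (\<phi> ` U) \<and>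
     homeomorphic_map (subtopology T U) (top_of_set (\<phi> ` U)) \<phi>)"

locale lie_group = group G
  for G :: "('g, 'm) monoid_scheme" (structure)
    and T :: "'g topology"
    and \<A> :: "('g, 'e::euclidean_space) chart set" +
  assumes topspace: "topspace T = carrier G"
    and hausdorff: "Hausdorff_space T"
    and second_countable: "second_countable T"
    and charts: "\<And>c. c \<in> \<A> \<Longrightarrow> is_chart T c"
    and cover: "(\<Union>(U, \<phi>)\<in>\<A>. U) = carrier G"
    and transition: "\<And>U \<phi> V \<psi>. (U, \<phi>) \<in> \<A> \<Longrightarrow> (V, \<psi>) \<in> \<A> \<Longrightarrow>
      smooth_on (\<phi> ` (U \<inter> V)) (\<lambda>x. \<psi> (inv_into U \<phi> x))"
    and mult_continuous: "continuous_map (prod_topology T T) T (\<lambda>(g, h). g \<otimes> h)"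
    and mult_smooth: "\<And>U \<phi> V \<psi> W \<theta>. (U, \<phi>) \<in> \<A> \<Longrightarrow> (V, \<psi>) \<in> \<A> \<Longrightarrow> (W, \<theta>) \<in> \<A> \<Longrightarrow>
      smooth_on {(x, y). x \<in> \<phi> ` U \<and> y \<in> \<psi> ` V \<and> inv_into U \<phi> x \<otimes> inv_into V \<psi> y \<in> W}
        (\<lambda>(x, y). \<theta> (inv_into U \<phi> x \<otimes> inv_into V \<psi> y))"
    and inv_continuous: "continuous_map T T (\<lambda>g. inv g)"
    and inv_smooth: "\<And>U \<phi> V \<psi>. (U, \<phi>) \<in> \<A> \<Longrightarrow> (V, \<psi>) \<in> \<A> \<Longrightarrow>
      smooth_on {x \<in> \<phi> ` U. inv (inv_into U \<phi> x) \<in> V} (\<lambda>x. \<psi> (inv (inv_into U \<phi> x)))"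

text \<open>Non-commutativity is required of two elements of the identity component. For connected \<open>G\<close>
  this just says that \<open>G\<close> is non-abelian. For disconnected groups such as \<open>O(2)\<close>, non-commutativity
  of \<open>G\<close> itself would not force \<open>\<gg>\<close> to be non-abelian.\<close>

definition nonabelian_lie_group :: "('g, 'm) monoid_scheme \<Rightarrow> 'g topology \<Rightarrow> bool" where
  "nonabelian_lie_group G T \<longleftrightarrow>
     (\<exists>g \<in> connected_component_of_set T \<one>\<^bsub>G\<^esub>. \<exists>h \<in> connected_component_of_set T \<one>\<^bsub>G\<^esub>.
        g \<otimes>\<^bsub>G\<^esub> h \<noteq> h \<otimes>\<^bsub>G\<^esub> g)"

text \<open>A chart \<open>(U, \<phi>)\<close> around the identity identifies the tangent space at the identity with the
  model space \<open>'e\<close>. In this chart, the left-invariant vector field with value \<open>v\<close> at the identity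
  has the value \<open>D(\<phi> \<circ> L\<^sub>g \<circ> \<phi>\<^sup>-\<^sup>1) v\<close> at \<open>x = \<phi> g\<close>, the derivative being taken at the identity.\<close>

definition left_invariant_field ::
  "('g, 'm) monoid_scheme \<Rightarrow> ('g, 'e::euclidean_space) chart \<Rightarrow> 'e \<Rightarrow> 'e \<Rightarrow> 'e" where
  "left_invariant_field G c v x = (case c of (U, \<phi>) \<Rightarrow>
     frechet_derivative (\<lambda>y. \<phi> (inv_into U \<phi> x \<otimes>\<^bsub>G\<^esub> inv_into U \<phi> y)) (at (\<phi> \<one>\<^bsub>G\<^esub>)) v)"

text \<open>The Lie bracket of \<open>\<gg>\<close>: the commutator \<open>[A, B] = DB(A) - DA(B)\<close> of the left-invariant vector
  fields extending \<open>u\<close> and \<open>v\<close>, evaluated at the identity.\<close>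

definition lie_bracket ::
  "('g, 'm) monoid_scheme \<Rightarrow> ('g, 'e::euclidean_space) chart \<Rightarrow> 'e \<Rightarrow> 'e \<Rightarrow> 'e" where
  "lie_bracket G c u v =
     (let e = snd c \<one>\<^bsub>G\<^esub>; A = left_invariant_field G c u; B = left_invariant_field G c v
      in frechet_derivative B (at e) (A e) - frechet_derivative A (at e) (B e))"

section \<open>Octonions\<close>

text \<open>The total antisymmetrisation of the listed values, each given at increasing indices.\<close>

definition oct_f0 :: "nat \<Rightarrow> nat \<Rightarrow> nat \<Rightarrow> real" where
  "oct_f0 i j k =
     (if (i, j, k) \<in> {(1,2,3), (1,4,5), (1,6,7), (2,4,6)} then 1
      else if (i, j, k) \<in> {(2,5,7), (3,4,7), (3,5,6)} then -1 else 0)"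

definition oct_f :: "nat \<Rightarrow> nat \<Rightarrow> nat \<Rightarrow> real" where
  "oct_f i j k = oct_f0 i j k + oct_f0 j k i + oct_f0 k i j
               - oct_f0 j i k - oct_f0 i k j - oct_f0 k j i"

text \<open>\<open>oct_coeff i j k\<close> is the coefficient of \<open>e\<^sub>k\<close> in \<open>e\<^sub>i e\<^sub>j\<close>, for \<open>i, j, k \<le> 7\<close>.\<close>

definition oct_coeff :: "nat \<Rightarrow> nat \<Rightarrow> nat \<Rightarrow> real" where
  "oct_coeff i j k =
     (if i = 0 then (if k = j then 1 else 0)
      else if j = 0 then (if k = i then 1 else 0)
      else if k = 0 then (if i = j then -1 else 0)
      else oct_f i j k)"

section \<open>Maps from the unit interval to \<open>\<gg> \<otimes> \<real>\<^sup>8\<close>\<close>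

text \<open>A map \<open>X : [0,1] \<rightarrow> \<gg> \<otimes> \<real>\<^sup>8\<close> is given by components \<open>X 0, \<dots>, X 7\<close>; components of index above 7
  and values outside of \<open>[0,1]\<close> are irrelevant. The derivatives at the end points are one-sided.\<close>

type_synonym 'e oct_path = "nat \<Rightarrow> real \<Rightarrow> 'e"

definition C1_unit :: "(real \<Rightarrow> 'e::real_normed_vector) \<Rightarrow> bool" where
  "C1_unit f \<longleftrightarrow> (\<exists>f'. continuous_on {0..1} f' \<and>
     (\<forall>t\<in>{0..1}. (f has_vector_derivative f' t) (at t within {0..1})))"

abbreviation ddt :: "(real \<Rightarrow> 'e::real_normed_vector) \<Rightarrow> real \<Rightarrow> 'e" where
  "ddt f t \<equiv> vector_derivative f (at t within {0..1})"

definition V_space :: "'e::real_normed_vector oct_path set" where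
  "V_space = {X. \<forall>k\<in>{0..7}. C1_unit (X k)}"

text \<open>Left multiplication by \<open>e\<^sub>i\<close>.\<close>

definition cplx_struct :: "nat \<Rightarrow> 'e::real_normed_vector oct_path \<Rightarrow> 'e oct_path" where
  "cplx_struct i Y = (\<lambda>k t. \<Sum>j=0..7. oct_coeff i j k *\<^sub>R Y j t)"

context
  fixes br :: "'e::real_normed_vector \<Rightarrow> 'e \<Rightarrow> 'e"
begin

definition N_oct :: "'e oct_path set" where
  "N_oct = {X \<in> V_space. \<forall>k\<in>{1..7}. \<forall>t\<in>{0..1}.
     ddt (X k) t + br (X 0 t) (X k t)
       + (1/2) *\<^sub>R (\<Sum>j=1..7. \<Sum>l=1..7. oct_f k j l *\<^sub>R br (X j t) (X l t)) = 0}"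

definition tangent_N_oct :: "'e oct_path \<Rightarrow> 'e oct_path set" where
  "tangent_N_oct X = {Y \<in> V_space. \<forall>k\<in>{1..7}. \<forall>t\<in>{0..1}.
     ddt (Y k) t + br (X 0 t) (Y k t) + br (Y 0 t) (X k t)
       + (1/2) *\<^sub>R (\<Sum>j=1..7. \<Sum>l=1..7.
           oct_f k j l *\<^sub>R (br (X j t) (Y l t) + br (Y j t) (X l t))) = 0}"

text \<open>The tangent space at \<open>[X]\<close> of the quotient of \<open>N_oct\<close> by the based gauge group, identified
  with the solutions of the gauge-fixing equation in the tangent space of \<open>N_oct\<close> at \<open>X\<close>.\<close>

definition tangent_M_oct :: "'e oct_path \<Rightarrow> 'e oct_path set" where
  "tangent_M_oct X = {Y \<in> tangent_N_oct X. \<forall>t\<in>{0..1}.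
     ddt (Y 0) t + (\<Sum>k=0..7. br (X k t) (Y k t)) = 0}"

end

end

theory Submission
  imports Defs
begin

text \<open>Let \<open>X = A e\<^sub>a\<close> be constant. The tangent equations at \<open>X\<close>, including the gauge fixing one, say
  \<open>Y' = [A, Y] e\<^sub>a\<close>, with octonion multiplication from the right. If \<open>e\<^sub>p\<close> is orthogonal to the quaternion
  algebra generated by \<open>e\<^sub>i\<close> and \<open>e\<^sub>a\<close>, with \<open>a \<noteq> i\<close>, then \<open>e\<^sub>i (e\<^sub>p e\<^sub>a) = - (e\<^sub>i e\<^sub>p) e\<^sub>a\<close>. Hence if \<open>Y\<close> solves this
  linear equation with \<open>Y(0) = B e\<^sub>p\<close>, then \<open>e\<^sub>i Y\<close> violates it at \<open>t = 0\<close> as soon as \<open>[A, B] \<noteq> 0\<close>, and the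
  same \<open>X\<close> and \<open>Y\<close> refute both invariance claims.

  That \<open>[A, B] \<noteq> 0\<close> for some \<open>A\<close>, \<open>B\<close> is shown without exponential maps. If the bracket vanishes, the
  derivative of \<open>Ad\<close> vanishes at the identity, and by the homomorphism property near it, so \<open>Ad\<close> is
  locally trivial. Then the commutators \<open>g y g\<^sup>-\<^sup>1 y\<^sup>-\<^sup>1\<close> have vanishing derivative in \<open>y\<close>, and a
  neighbourhood of the identity is commutative. Centralisers of its elements are open subgroups, and
  therefore contain the identity component.\<close>

section \<open>Calculus\<close>

text \<open>The solution is the exponential series of \<open>t L\<close> applied to
  \<open>v\<close>, which converges by comparison with the real exponential series.\<close>

lemma linear_ode_exists:
  fixes L :: "'a::euclidean_space \<Rightarrow> 'a"
  assumes L: "bounded_linear L"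
  shows "\<exists>y. y 0 = v \<and> (\<forall>t. (y has_vector_derivative L (y t)) (at t))"
proof -
  define y where "y t = (\<Sum>n. (t ^ n / fact n) *\<^sub>R (L ^^ n) v)" for t
  obtain K where K: "K > 0" "\<And>x. norm (L x) \<le> norm x * K"
    using bounded_linear.pos_bounded[OF L] by auto
  have norm_pow: "norm ((L ^^ n) w) \<le> norm w * K ^ n" for n w
  proof (induction n)
    case (Suc n)
    have "norm ((L ^^ Suc n) w) \<le> norm ((L ^^ n) w) * K"
      using K(2) by simp
    also have "\<dots> \<le> norm w * K ^ n * K"
      using Suc K(1) by (intro mult_right_mono) auto
    finally show ?case by (simp add: mult_ac)
  qed simp
  have summ: "summable (\<lambda>n. (t ^ n / fact n) *\<^sub>R (L ^^ n) w)" for t w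
  proof (rule summable_norm_cancel, rule summable_comparison_test')
    show "summable (\<lambda>n. norm w * ((\<bar>t\<bar> * K) ^ n /\<^sub>R fact n))"
      by (intro summable_mult summable_exp_generic)
    show "norm (norm ((t ^ n / fact n) *\<^sub>R (L ^^ n) w)) \<le> norm w * ((\<bar>t\<bar> * K) ^ n /\<^sub>R fact n)"
      if "n \<ge> 0" for n
    proof -
      have "norm (norm ((t ^ n / fact n) *\<^sub>R (L ^^ n) w)) = (\<bar>t\<bar> ^ n / fact n) * norm ((L ^^ n) w)"
        by (simp add: power_abs)
      also have "\<dots> \<le> (\<bar>t\<bar> ^ n / fact n) * (norm w * K ^ n)"
        by (intro mult_left_mono norm_pow) auto
      finally show ?thesis by (simp add: power_mult_distrib field_simps)
    qed
  qed
  have y0: "y 0 = v"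
  proof -
    have "(\<lambda>n. (0 ^ n / fact n) *\<^sub>R (L ^^ n) v) = (\<lambda>n. if n = 0 then v else 0)"
      by (auto simp: fun_eq_iff)
    then show ?thesis
      unfolding y_def using suminf_finite[of "{0}" "\<lambda>n. if n = 0 then v else 0"] by simp
  qed
  \<comment> \<open>Paired with a fixed \<open>b\<close>, the series is a real power series in
    \<open>t\<close>, so it may be differentiated termwise. The coefficient shift in
    \<open>diffs\<close> is one further application of \<open>L\<close>, the factor
    \<open>Suc n\<close> cancelling against the factorial.\<close>
  have deriv: "((\<lambda>t. y t \<bullet> b) has_real_derivative (L (y t) \<bullet> b)) (at t)" for t b
  proof -
    define c where "c n = ((L ^^ n) v \<bullet> b) / fact n" for n
    have c_inner: "c n * s ^ n = ((s ^ n / fact n) *\<^sub>R (L ^^ n) v) \<bullet> b" for s n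
      by (simp add: c_def)
    have c_summ: "summable (\<lambda>n. c n * s ^ n)" for s
      unfolding c_inner by (rule bounded_linear.summable[OF bounded_linear_inner_left summ])
    have y_c: "y s \<bullet> b = (\<Sum>n. c n * s ^ n)" for s
      unfolding c_inner y_def by (rule bounded_linear.suminf[OF bounded_linear_inner_left summ])
    have "L (y t) = (\<Sum>n. (t ^ n / fact n) *\<^sub>R (L ^^ Suc n) v)"
      unfolding y_def using bounded_linear.suminf[OF L summ, of t v]
      by (simp add: linear_cmul bounded_linear.linear[OF L])
    then have "L (y t) \<bullet> b = (\<Sum>n. ((t ^ n / fact n) *\<^sub>R (L ^^ n) (L v)) \<bullet> b)"
      using bounded_linear.suminf[OF bounded_linear_inner_left summ[of t "L v"], of b]
      by (simp add: funpow_swap1)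
    also have "\<dots> = (\<Sum>n. diffs c n * t ^ n)"
      by (intro suminf_cong) (simp add: diffs_def c_def funpow_swap1 divide_simps del: of_nat_Suc)
    finally show ?thesis
      unfolding y_c using termdiffs_strong_converges_everywhere[of c t] c_summ by simp
  qed
  have "(y has_vector_derivative L (y t)) (at t)" for t
    unfolding has_vector_derivative_def
  proof (subst has_derivative_componentwise_within, intro ballI)
    fix b :: 'a assume "b \<in> Basis"
    show "((\<lambda>x. y x \<bullet> b) has_derivative (\<lambda>x. (x *\<^sub>R L (y t)) \<bullet> b)) (at t)"
      by (rule has_derivative_eq_rhs[OF deriv[of b t, unfolded has_field_derivative_def]]) (simp add: fun_eq_iff)
  qed
  with y0 show ?thesis by blast
qed

text \<open>A product rule for \<open>M x (w x)\<close>. Differentiability of \<open>M\<close> in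
  \<open>x\<close> for each fixed vector suffices because a linear map on a Euclidean space is a
  finite combination of its values on \<open>Basis\<close>. Linearity is asked for only near
  \<open>x0\<close>, since derivatives of the group law are known to be linear only on an open
  domain.\<close>

lemma has_derivative_linear_family_apply:
  fixes M :: "'x::real_normed_vector \<Rightarrow> 'a::euclidean_space \<Rightarrow> 'b::real_normed_vector"
  assumes lin: "\<forall>\<^sub>F x in nhds x0. linear (M x)"
    and M: "\<And>v. ((\<lambda>x. M x v) has_derivative M' v) (at x0)"
    and w: "(w has_derivative w') (at x0)"
  shows "((\<lambda>x. M x (w x)) has_derivative (\<lambda>h. M' (w x0) h + M x0 (w' h))) (at x0)"
proof -
  have expand: "\<forall>\<^sub>F x in nhds x0. \<forall>v. M x v = (\<Sum>b\<in>Basis. (v \<bullet> b) *\<^sub>R M x b)"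
    using lin
  proof eventually_elim
    case (elim x)
    show ?case
    proof
      fix v
      have "M x v = M x (\<Sum>b\<in>Basis. (v \<bullet> b) *\<^sub>R b)"
        by (simp add: euclidean_representation)
      then show "M x v = (\<Sum>b\<in>Basis. (v \<bullet> b) *\<^sub>R M x b)"
        by (simp add: linear_sum[OF elim] linear_cmul[OF elim])
    qed
  qed
  have expand0: "M x0 v = (\<Sum>b\<in>Basis. (v \<bullet> b) *\<^sub>R M x0 b)" for v
    using eventually_nhds_x_imp_x[OF expand] by blast
  have D: "((\<lambda>x. M x (u x)) has_derivative
      (\<lambda>h. \<Sum>b\<in>Basis. (u x0 \<bullet> b) *\<^sub>R M' b h + (u' h \<bullet> b) *\<^sub>R M x0 b)) (at x0)"
    if u: "(u has_derivative u') (at x0)" for u u'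
  proof (rule has_derivative_transform_eventually)
    show "((\<lambda>x. \<Sum>b\<in>Basis. (u x \<bullet> b) *\<^sub>R M x b) has_derivative
      (\<lambda>h. \<Sum>b\<in>Basis. (u x0 \<bullet> b) *\<^sub>R M' b h + (u' h \<bullet> b) *\<^sub>R M x0 b)) (at x0)"
      by (intro has_derivative_sum has_derivative_scaleR has_derivative_inner_left u M)
    show "\<forall>\<^sub>F x in at x0. (\<Sum>b\<in>Basis. (u x \<bullet> b) *\<^sub>R M x b) = M x (u x)"
      using filter_leD[OF at_within_le_nhds expand] by eventually_elim metis
    show "(\<Sum>b\<in>Basis. (u x0 \<bullet> b) *\<^sub>R M x0 b) = M x0 (u x0)"
      using expand0[of "u x0"] by simp
  qed simp
  \<comment> \<open>Linearity of \<open>M' v\<close> in \<open>v\<close> follows from uniqueness of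
    derivatives: \<open>D\<close> is applied to the constant map with value
    \<open>v\<close>.\<close>
  have expand': "M' v h = (\<Sum>b\<in>Basis. (v \<bullet> b) *\<^sub>R M' b h)" for v h
    using has_derivative_unique[OF M D[OF has_derivative_const[of v]]] by (auto dest: fun_cong)
  have "M' (w x0) h + M x0 (w' h) =
      (\<Sum>b\<in>Basis. (w x0 \<bullet> b) *\<^sub>R M' b h + (w' h \<bullet> b) *\<^sub>R M x0 b)" for h
    unfolding sum.distrib by (rule arg_cong2[where f = "(+)", OF expand' expand0])
  then show ?thesis
    using D[OF w] by simp
qed

section \<open>Symmetry of second derivatives\<close>

lemma Ck_on_Suc_differentiable:
  "Ck_on (Suc k) S f \<Longrightarrow> x \<in> S \<Longrightarrow> (f has_derivative frechet_derivative f (at x)) (at x)"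
  by (simp add: frechet_derivative_works)

lemma Ck_on_frechet_derivative:
  "Ck_on (Suc k) S f \<Longrightarrow> Ck_on k S (\<lambda>x. frechet_derivative f (at x) v)"
  by simp

lemma has_derivative_along_line:
  assumes "(f has_derivative f') (at (p + s *\<^sub>R v))"
  shows "((\<lambda>s. f (p + s *\<^sub>R v)) has_derivative (\<lambda>h. f' (h *\<^sub>R v))) (at s within A)"
proof -
  have "((\<lambda>s. p + s *\<^sub>R v) has_derivative (\<lambda>h. h *\<^sub>R v)) (at s within A)"
    by (rule has_derivative_eq_rhs[OF has_derivative_add[OF has_derivative_const
          has_derivative_scaleR_left[OF has_derivative_ident]]]) simp
  from has_derivative_compose[OF this, where g = f and g' = f'] assms show ?thesis by simp
qed

text \<open>The mean value theorem is applied twice: along \<open>v\<close> to the difference of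
  \<open>f\<close> across a side \<open>h *\<^sub>R w\<close>, then along \<open>w\<close> to the
  resulting derivative. Pairing with \<open>b\<close> makes the functions real-valued, as the mean
  value equality requires.\<close>

lemma second_difference_mean_value:
  fixes f :: "'a::euclidean_space \<Rightarrow> 'b::euclidean_space"
  assumes f: "Ck_on (Suc (Suc 0)) S f" and h: "h > 0"
    and S: "\<And>s t. 0 \<le> s \<Longrightarrow> s \<le> h \<Longrightarrow> 0 \<le> t \<Longrightarrow> t \<le> h \<Longrightarrow> p + s *\<^sub>R v + t *\<^sub>R w \<in> S"
  shows "\<exists>s t. 0 \<le> s \<and> s \<le> h \<and> 0 \<le> t \<and> t \<le> h \<and>
    (f (p + h *\<^sub>R v + h *\<^sub>R w) - f (p + h *\<^sub>R v) - f (p + h *\<^sub>R w) + f p) \<bullet> b =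
    h * h * (frechet_derivative (\<lambda>x. frechet_derivative f (at x) v) (at (p + s *\<^sub>R v + t *\<^sub>R w)) w \<bullet> b)"
proof -
  let ?D = "\<lambda>x. frechet_derivative f (at x)"
  let ?H = "\<lambda>x. frechet_derivative (\<lambda>x. ?D x v) (at x)"
  have D: "(f has_derivative ?D x) (at x)" if "x \<in> S" for x
    using Ck_on_Suc_differentiable[OF f that] .
  have H: "((\<lambda>x. ?D x v) has_derivative ?H x) (at x)" if "x \<in> S" for x
    using Ck_on_Suc_differentiable[OF Ck_on_frechet_derivative[OF f] that] .
  let ?g = "\<lambda>s. (f ((p + h *\<^sub>R w) + s *\<^sub>R v) - f (p + s *\<^sub>R v)) \<bullet> b"
  have g: "(?g has_derivative (\<lambda>k. (?D ((p + h *\<^sub>R w) + s *\<^sub>R v) (k *\<^sub>R v) - ?D (p + s *\<^sub>R v) (k *\<^sub>R v)) \<bullet> b))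
      (at s within {0..h})" if "0 \<le> s" "s \<le> h" for s
    using that S[of s h] S[of s 0] h
    by (intro has_derivative_inner_left has_derivative_diff has_derivative_along_line D) (auto simp: algebra_simps)
  obtain s where s: "0 < s" "s < h"
    and gs: "?g h - ?g 0 = (?D ((p + h *\<^sub>R w) + s *\<^sub>R v) ((h - 0) *\<^sub>R v) - ?D (p + s *\<^sub>R v) ((h - 0) *\<^sub>R v)) \<bullet> b"
    using mvt_simple[OF h, of ?g, OF g] by (auto simp del: diff_zero)
  let ?k = "\<lambda>t. ?D ((p + s *\<^sub>R v) + t *\<^sub>R w) v \<bullet> b"
  have k: "(?k has_derivative (\<lambda>r. ?H ((p + s *\<^sub>R v) + t *\<^sub>R w) (r *\<^sub>R w) \<bullet> b)) (at t within {0..h})"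
    if "0 \<le> t" "t \<le> h" for t
    using that S[of s t] s
    by (intro has_derivative_inner_left has_derivative_along_line H) auto
  obtain t where t: "0 < t" "t < h"
    and kt: "?k h - ?k 0 = ?H ((p + s *\<^sub>R v) + t *\<^sub>R w) ((h - 0) *\<^sub>R w) \<bullet> b"
    using mvt_simple[OF h, of ?k, OF k] by (auto simp del: diff_zero)
  have lin: "?D x (h *\<^sub>R v) = h *\<^sub>R ?D x v" "?H x (h *\<^sub>R w) = h *\<^sub>R ?H x w" if "x \<in> S" for x
    using D[OF that] H[OF that] by (simp_all add: has_derivative_linear linear_cmul)
  have inS: "p + h *\<^sub>R w + s *\<^sub>R v \<in> S" "p + s *\<^sub>R v \<in> S" "p + s *\<^sub>R v + t *\<^sub>R w \<in> S"
    using S[of s h] S[of s 0] S[of s t] s t h by (auto simp: algebra_simps)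
  have "?g h - ?g 0 = h * (?k h - ?k 0)"
    using gs lin(1)[OF inS(1)] lin(1)[OF inS(2)] by (simp add: algebra_simps)
  also have "\<dots> = h * h * (?H (p + s *\<^sub>R v + t *\<^sub>R w) w \<bullet> b)"
    using kt lin(2)[OF inS(3)] by simp
  finally have "(f (p + h *\<^sub>R v + h *\<^sub>R w) - f (p + h *\<^sub>R v) - f (p + h *\<^sub>R w) + f p) \<bullet> b =
      h * h * (?H (p + s *\<^sub>R v + t *\<^sub>R w) w \<bullet> b)"
    by (simp add: algebra_simps)
  with s t show ?thesis by (intro exI[of _ s] exI[of _ t]) auto
qed

text \<open>The second difference over a parallelogram is symmetric in \<open>v\<close> and
  \<open>w\<close>. By the mean value formula it makes the two mixed derivatives agree at a pair of
  points near \<open>p\<close>, and continuity carries this to \<open>p\<close> up to an arbitrary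
  error.\<close>

lemma frechet_derivative_commute:
  fixes f :: "'a::euclidean_space \<Rightarrow> 'b::euclidean_space"
  assumes f: "Ck_on (Suc (Suc 0)) S f" and S: "open S" "p \<in> S"
  shows "frechet_derivative (\<lambda>x. frechet_derivative f (at x) v) (at p) w =
         frechet_derivative (\<lambda>x. frechet_derivative f (at x) w) (at p) v"
proof (rule euclidean_eqI)
  fix b :: 'b
  define H where "H v w x = frechet_derivative (\<lambda>x. frechet_derivative f (at x) v) (at x) w \<bullet> b" for v w x
  have "continuous_on S (H v w)" for v w
    using f unfolding H_def by (auto intro!: continuous_intros)
  then have cont: "continuous (at p) (H v w)" for v w
    using S continuous_on_eq_continuous_at by blast
  have "\<bar>H v w p - H w v p\<bar> \<le> e" if "e > 0" for e
  proof -
    have near: "\<exists>d>0. \<forall>x. dist x p < d \<longrightarrow> \<bar>H v w x - H v w p\<bar> < e / 2" for v w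
      using cont[of v w] half_gt_zero[OF \<open>e > 0\<close>] unfolding continuous_at_eps_delta dist_real_def by blast
    obtain d1 where d1: "d1 > 0" "\<And>x. dist x p < d1 \<Longrightarrow> \<bar>H v w x - H v w p\<bar> < e / 2"
      using near[of v w] by auto
    obtain d2 where d2: "d2 > 0" "\<And>x. dist x p < d2 \<Longrightarrow> \<bar>H w v x - H w v p\<bar> < e / 2"
      using near[of w v] by auto
    obtain d3 where d3: "d3 > 0" "ball p d3 \<subseteq> S"
      using S by (meson openE)
    define d where "d = min d1 (min d2 d3)"
    \<comment> \<open>A side length that keeps the whole parallelogram within distance
      \<open>d\<close> of \<open>p\<close>; the summand 1 keeps the denominator positive when
      \<open>v\<close> and \<open>w\<close> vanish.\<close>
    define h where "h = d / (2 * (norm v + norm w + 1))"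
    have h: "h > 0"
      unfolding h_def d_def using d1 d2 d3 by (auto intro!: divide_pos_pos add_nonneg_pos)
    have nv: "norm v + norm w + 1 > 0"
      by (intro add_nonneg_pos) auto
    have in_ball: "dist (p + s *\<^sub>R v + t *\<^sub>R w) p < d"
      if "0 \<le> s" "s \<le> h" "0 \<le> t" "t \<le> h" for s t
    proof -
      have "dist (p + s *\<^sub>R v + t *\<^sub>R w) p \<le> s * norm v + t * norm w"
        using that norm_triangle_ineq[of "s *\<^sub>R v" "t *\<^sub>R w"] by (simp add: dist_norm)
      also have "\<dots> \<le> h * norm v + h * norm w"
        using that by (intro add_mono mult_right_mono) auto
      also have "\<dots> < h * (2 * (norm v + norm w + 1))"
      proof -
        have "norm v + norm w < 2 * (norm v + norm w + 1)"
          using nv by simp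
        from mult_strict_left_mono[OF this h] show ?thesis
          by (simp add: distrib_left)
      qed
      also have "\<dots> = d"
        using nv by (simp add: h_def)
      finally show ?thesis .
    qed
    have inS: "p + s *\<^sub>R v + t *\<^sub>R w \<in> S" if "0 \<le> s" "s \<le> h" "0 \<le> t" "t \<le> h" for s t
      using in_ball[OF that] d3 by (auto simp: d_def dist_commute)
    obtain s t where st: "0 \<le> s" "s \<le> h" "0 \<le> t" "t \<le> h" and
      1: "(f (p + h *\<^sub>R v + h *\<^sub>R w) - f (p + h *\<^sub>R v) - f (p + h *\<^sub>R w) + f p) \<bullet> b =
          h * h * H v w (p + s *\<^sub>R v + t *\<^sub>R w)"
      using second_difference_mean_value[OF f h inS, of b] unfolding H_def by blast
    have inS': "p + s *\<^sub>R w + t *\<^sub>R v \<in> S" if "0 \<le> s" "s \<le> h" "0 \<le> t" "t \<le> h" for s t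
      using inS[of t s] that by (simp add: algebra_simps)
    obtain s' t' where st': "0 \<le> s'" "s' \<le> h" "0 \<le> t'" "t' \<le> h" and
      2: "(f (p + h *\<^sub>R w + h *\<^sub>R v) - f (p + h *\<^sub>R w) - f (p + h *\<^sub>R v) + f p) \<bullet> b =
          h * h * H w v (p + s' *\<^sub>R w + t' *\<^sub>R v)"
      using second_difference_mean_value[OF f h inS', of b] unfolding H_def by blast
    have "h * h * H v w (p + s *\<^sub>R v + t *\<^sub>R w) = h * h * H w v (p + s' *\<^sub>R w + t' *\<^sub>R v)"
      unfolding 1[symmetric] 2[symmetric] by (simp add: algebra_simps)
    then have eq: "H v w (p + s *\<^sub>R v + t *\<^sub>R w) = H w v (p + t' *\<^sub>R v + s' *\<^sub>R w)"
      using h by (simp add: algebra_simps)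
    have "\<bar>H v w (p + s *\<^sub>R v + t *\<^sub>R w) - H v w p\<bar> < e / 2"
      using in_ball[OF st] by (intro d1(2)) (simp add: d_def)
    moreover have "\<bar>H w v (p + t' *\<^sub>R v + s' *\<^sub>R w) - H w v p\<bar> < e / 2"
      using in_ball[OF st'(3,4,1,2)] by (intro d2(2)) (simp add: d_def)
    ultimately show ?thesis
      unfolding eq abs_if by (simp split: if_splits)
  qed
  then have "\<bar>H v w p - H w v p\<bar> \<le> 0"
    by (rule field_le_epsilon) simp
  then show "frechet_derivative (\<lambda>x. frechet_derivative f (at x) v) (at p) w \<bullet> b =
         frechet_derivative (\<lambda>x. frechet_derivative f (at x) w) (at p) v \<bullet> b"
    by (simp add: H_def)
qed

lemma linear_pair_zero: "linear (\<lambda>v. (v, 0))" and linear_zero_pair: "linear (\<lambda>v. (0, v))"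
  by (auto intro!: linearI)

section \<open>Lie groups in a chart at the identity\<close>

lemma has_derivative_transform_nhds:
  assumes f: "(f has_derivative F) (at x)" and fg: "\<forall>\<^sub>F y in nhds x. f y = g y"
  shows "(g has_derivative F) (at x)"
  using has_derivative_transform_eventually[OF f filter_leD[OF at_within_le_nhds fg]
      eventually_nhds_x_imp_x[OF fg]] by simp

lemma eventually_nhds_preimage:
  assumes "(f has_derivative F) (at x)" "open S" "f x \<in> S"
  shows "\<forall>\<^sub>F y in nhds x. f y \<in> S"
  using has_derivative_continuous[OF assms(1)] assms(2,3)
  unfolding continuous_at_open eventually_nhds by blast

section \<open>Subgroups and the identity component\<close>

context lie_group
begin

lemma continuous_map_left_mult:
  assumes "g \<in> carrier G"
  shows "continuous_map T T (\<lambda>x. g \<otimes> x)"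
proof -
  have "continuous_map T (prod_topology T T) (\<lambda>x. (g, x))"
    using assms topspace by (intro continuous_map_pairedI) auto
  from continuous_map_compose[OF this mult_continuous] show ?thesis
    by (simp add: o_def)
qed

lemma openin_left_translate:
  assumes "openin T W" "g \<in> carrier G"
  shows "openin T {x \<in> carrier G. g \<otimes> x \<in> W}"
  using openin_continuous_map_preimage[OF continuous_map_left_mult assms(1)] assms(2) topspace by simp

text \<open>Left translates of \<open>W\<close> show that \<open>H\<close> is open, and so is its
  complement: if \<open>g\<close> lies outside \<open>H\<close>, then \<open>g W\<close> misses
  \<open>H\<close>. A connected set meeting the clopen set \<open>H\<close> is contained in
  it.\<close>

lemma identity_component_subset_subgroup:
  assumes H: "subgroup H G" and W: "openin T W" "\<one> \<in> W" "W \<subseteq> H"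
  shows "connected_component_of_set T \<one> \<subseteq> H"
proof -
  have HG: "H \<subseteq> carrier G"
    using subgroup.subset[OF H] .
  have "openin T H"
  proof (subst openin_subopen, intro ballI)
    fix h assume h: "h \<in> H"
    have hG: "h \<in> carrier G" and ihG: "inv h \<in> carrier G"
      using h HG by auto
    have "{x \<in> carrier G. inv h \<otimes> x \<in> W} \<subseteq> H"
    proof
      fix x assume x: "x \<in> {x \<in> carrier G. inv h \<otimes> x \<in> W}"
      then have "h \<otimes> (inv h \<otimes> x) \<in> H"
        using W(3) subgroup.m_closed[OF H h] by blast
      moreover have "h \<otimes> (inv h \<otimes> x) = x"
        using x hG by (simp add: m_assoc[symmetric])
      ultimately show "x \<in> H" by simp
    qed
    then show "\<exists>V. openin T V \<and> h \<in> V \<and> V \<subseteq> H"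
      using openin_left_translate[OF W(1) ihG] hG W(2) by (intro exI conjI) auto
  qed
  moreover have "openin T (carrier G - H)"
  proof (subst openin_subopen, intro ballI)
    fix g assume g: "g \<in> carrier G - H"
    have gG: "g \<in> carrier G" and igG: "inv g \<in> carrier G"
      using g by auto
    have "x \<notin> H" if x: "x \<in> carrier G" "inv g \<otimes> x \<in> W" for x
    proof
      assume xH: "x \<in> H"
      have "x \<otimes> inv (inv g \<otimes> x) \<in> H"
        using xH x(2) W(3) subgroup.m_closed[OF H] subgroup.m_inv_closed[OF H] by blast
      moreover have "x \<otimes> inv (inv g \<otimes> x) = g"
        using x(1) gG by (simp add: inv_mult_group m_assoc[symmetric])
      ultimately show False using g by simp
    qed
    then show "\<exists>V. openin T V \<and> g \<in> V \<and> V \<subseteq> carrier G - H"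
      using openin_left_translate[OF W(1) igG] gG W(2)
      by (intro exI[of _ "{x \<in> carrier G. inv g \<otimes> x \<in> W}"]) auto
  qed
  ultimately have "connected_component_of_set T \<one> \<subseteq> H \<or> disjnt (connected_component_of_set T \<one>) H"
    using HG topspace
    by (intro connectedin_clopen_cases[OF connectedin_connected_component_of]) (auto simp: closedin_def)
  moreover have "\<one> \<in> connected_component_of_set T \<one>" "\<one> \<in> H"
    using W topspace by (auto simp: connected_component_of_refl)
  ultimately show ?thesis
    by (auto simp: disjnt_def)
qed

text \<open>Two passes with centralisers. That of an element of \<open>W\<close> contains
  \<open>W\<close>, hence the identity component. Therefore the centraliser of any \<open>g\<close>
  in the component again contains \<open>W\<close>, and so the component.\<close>

lemma identity_component_commutes:
  assumes W: "openin T W" "\<one> \<in> W" and comm: "\<And>g h. g \<in> W \<Longrightarrow> h \<in> W \<Longrightarrow> g \<otimes> h = h \<otimes> g"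
    and g: "g \<in> connected_component_of_set T \<one>" and h: "h \<in> connected_component_of_set T \<one>"
  shows "g \<otimes> h = h \<otimes> g"
proof -
  have WG: "W \<subseteq> carrier G"
    using W(1) topspace openin_subset by blast
  let ?C = "\<lambda>x. {y \<in> carrier G. x \<otimes> y = y \<otimes> x}"
  have sub: "subgroup (?C x) G" if x: "x \<in> carrier G" for x
  proof (rule subgroupI)
    show "?C x \<noteq> {}" using x by auto
  next
    fix a assume a: "a \<in> ?C x"
    then have aG: "a \<in> carrier G" by simp
    from a have "inv a \<otimes> (a \<otimes> x) \<otimes> inv a = inv a \<otimes> (x \<otimes> a) \<otimes> inv a" by simp
    moreover have "inv a \<otimes> (a \<otimes> x) \<otimes> inv a = x \<otimes> inv a"
      using aG x by (simp add: m_assoc[symmetric])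
    moreover have "inv a \<otimes> (x \<otimes> a) \<otimes> inv a = inv a \<otimes> x"
      using aG x by (simp add: m_assoc)
    ultimately show "inv a \<in> ?C x" using a by simp
  next
    fix a b assume ab: "a \<in> ?C x" "b \<in> ?C x"
    then have "x \<otimes> (a \<otimes> b) = (a \<otimes> x) \<otimes> b"
      using x by (simp add: m_assoc[symmetric])
    also have "\<dots> = a \<otimes> (b \<otimes> x)"
      using ab x by (simp add: m_assoc)
    finally show "a \<otimes> b \<in> ?C x"
      using ab x by (simp add: m_assoc)
  qed auto
  have 1: "y \<in> ?C x" if "x \<in> W" "y \<in> connected_component_of_set T \<one>" for x y
    using identity_component_subset_subgroup[OF sub W, of x] that WG comm by blast
  have gG: "g \<in> carrier G"
    using g topspace connected_component_of_subset_topspace by fastforce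
  have "W \<subseteq> ?C g"
    using 1 g WG by fastforce
  then show ?thesis
    using identity_component_subset_subgroup[OF sub[OF gG] W] h by blast
qed

end

section \<open>The group operations in a chart around the identity\<close>

locale lie_group_chart = lie_group G T \<A>
  for G :: "('g, 'm) monoid_scheme" (structure)
    and T :: "'g topology"
    and \<A> :: "('g, 'e::euclidean_space) chart set" +
  fixes U :: "'g set" and \<phi> :: "'g \<Rightarrow> 'e"
  assumes chart: "(U, \<phi>) \<in> \<A>" and one_in: "\<one> \<in> U"
begin

definition E :: "'e set" where "E = \<phi> ` U"
definition \<psi> :: "'e \<Rightarrow> 'g" where "\<psi> = inv_into U \<phi>"
definition e :: 'e where "e = \<phi> \<one>"
definition mult :: "'e \<times> 'e \<Rightarrow> 'e" where "mult = (\<lambda>(x, y). \<phi> (\<psi> x \<otimes> \<psi> y))"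
text \<open>The set on which \<open>mult_smooth\<close>, with the same chart in all three places,
  yields smoothness. Elsewhere \<open>mult\<close> evaluates \<open>\<phi>\<close> or
  \<open>\<psi>\<close> outside its meaningful range.\<close>

definition mult_dom :: "('e \<times> 'e) set" where
  "mult_dom = {(x, y). x \<in> E \<and> y \<in> E \<and> \<psi> x \<otimes> \<psi> y \<in> U}"
definition minv :: "'e \<Rightarrow> 'e" where "minv x = \<phi> (inv (\<psi> x))"
definition minv_dom :: "'e set" where "minv_dom = {x \<in> E. inv (\<psi> x) \<in> U}"

abbreviation Dmult :: "'e \<times> 'e \<Rightarrow> 'e \<times> 'e \<Rightarrow> 'e" where
  "Dmult p \<equiv> frechet_derivative mult (at p)"

lemma chart_props:
  "openin T U" "open E" "homeomorphic_map (subtopology T U) (top_of_set E) \<phi>"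
  using charts[OF chart] by (auto simp: is_chart_def E_def)

lemma U_carrier: "g \<in> U \<Longrightarrow> g \<in> carrier G"
  using chart_props(1) topspace openin_subset by blast

lemma inj_chart: "inj_on \<phi> U"
  using chart_props(3) U_carrier topspace
  by (metis homeomorphic_imp_injective_map Int_absorb1 subsetI topspace_subtopology)

lemma phi_in: "g \<in> U \<Longrightarrow> \<phi> g \<in> E"
  by (simp add: E_def)

lemma psi_in: "x \<in> E \<Longrightarrow> \<psi> x \<in> U"
  by (simp add: E_def \<psi>_def inv_into_into)

lemma psi_carrier: "x \<in> E \<Longrightarrow> \<psi> x \<in> carrier G"
  by (simp add: psi_in U_carrier)

lemma psi_phi: "g \<in> U \<Longrightarrow> \<psi> (\<phi> g) = g"
  by (simp add: \<psi>_def inj_chart)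

lemma phi_psi: "x \<in> E \<Longrightarrow> \<phi> (\<psi> x) = x"
  by (simp add: \<psi>_def E_def f_inv_into_f)

lemma e_in: "e \<in> E" and psi_e: "\<psi> e = \<one>"
  using one_in by (auto simp: e_def phi_in psi_phi)

text \<open>\<open>\<psi>\<close> is built by choosing preimages; on \<open>E\<close> it agrees with
  the continuous inverse that comes with the homeomorphism.\<close>

lemma continuous_psi: "continuous_map (top_of_set E) T \<psi>"
proof -
  obtain g where g: "homeomorphic_maps (subtopology T U) (top_of_set E) \<phi> g"
    using chart_props(3) homeomorphic_map_maps by blast
  then have "continuous_map (top_of_set E) (subtopology T U) g"
    by (simp add: homeomorphic_maps_def)
  moreover have "g x = \<psi> x" if "x \<in> E" for x
  proof -
    have "g (\<phi> (\<psi> x)) = \<psi> x"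
      using g psi_in[OF that] psi_carrier[OF that] topspace by (simp add: homeomorphic_maps_def)
    then show ?thesis by (simp add: phi_psi that)
  qed
  ultimately have "continuous_map (top_of_set E) (subtopology T U) \<psi>"
    by (auto intro: continuous_map_eq)
  then show ?thesis
    by (rule continuous_map_into_fulltopology)
qed

lemma open_mult_dom: "open mult_dom"
proof -
  have "continuous_map (top_of_set (E \<times> E)) (prod_topology T T) (\<lambda>p. (\<psi> (fst p), \<psi> (snd p)))"
  proof (intro continuous_map_pairedI)
    show "continuous_map (top_of_set (E \<times> E)) T (\<lambda>p. \<psi> (fst p))"
      by (rule continuous_map_compose[OF _ continuous_psi, unfolded o_def])
        (auto simp: continuous_on_fst continuous_on_id)
    show "continuous_map (top_of_set (E \<times> E)) T (\<lambda>p. \<psi> (snd p))"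
      by (rule continuous_map_compose[OF _ continuous_psi, unfolded o_def])
        (auto simp: continuous_on_snd continuous_on_id)
  qed
  from continuous_map_compose[OF this mult_continuous]
  have "continuous_map (top_of_set (E \<times> E)) T (\<lambda>p. \<psi> (fst p) \<otimes> \<psi> (snd p))"
    by (simp add: o_def)
  from openin_continuous_map_preimage[OF this chart_props(1)]
  have "openin (top_of_set (E \<times> E)) {p \<in> E \<times> E. \<psi> (fst p) \<otimes> \<psi> (snd p) \<in> U}"
    by simp
  then have "open {p \<in> E \<times> E. \<psi> (fst p) \<otimes> \<psi> (snd p) \<in> U}"
    using openin_open_trans open_Times[OF chart_props(2) chart_props(2)] by blast
  moreover have "{p \<in> E \<times> E. \<psi> (fst p) \<otimes> \<psi> (snd p) \<in> U} = mult_dom"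
    by (auto simp: mult_dom_def)
  ultimately show ?thesis by simp
qed

lemma open_minv_dom: "open minv_dom"
proof -
  have "continuous_map (top_of_set E) T (\<lambda>x. inv (\<psi> x))"
    using continuous_map_compose[OF continuous_psi inv_continuous] by (simp add: o_def)
  from openin_continuous_map_preimage[OF this chart_props(1)]
  have "openin (top_of_set E) minv_dom"
    by (simp add: minv_dom_def)
  then show ?thesis
    using openin_open_trans chart_props(2) by blast
qed

lemma smooth_mult: "Ck_on k mult_dom mult"
  using mult_smooth[OF chart chart chart]
  unfolding smooth_on_def mult_dom_def mult_def E_def \<psi>_def by blast

lemma smooth_minv: "Ck_on k minv_dom minv"
  using inv_smooth[OF chart chart]
  unfolding smooth_on_def minv_dom_def minv_def[abs_def] E_def \<psi>_def by blast

lemma mult_has_derivative: "p \<in> mult_dom \<Longrightarrow> (mult has_derivative Dmult p) (at p)"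
  using Ck_on_Suc_differentiable[OF smooth_mult] .

lemma linear_Dmult: "p \<in> mult_dom \<Longrightarrow> linear (Dmult p)"
  using mult_has_derivative has_derivative_linear by blast

text \<open>Derivatives of group-valued maps, read in the chart. Membership in \<open>U\<close> near
  the point is recorded because \<open>\<phi>\<close> carries no information outside
  \<open>U\<close>. Identities between such maps can then be derived by group algebra and
  differentiated afterwards.\<close>

definition chart_derivative :: "('x::real_normed_vector \<Rightarrow> 'g) \<Rightarrow> ('x \<Rightarrow> 'e) \<Rightarrow> 'x \<Rightarrow> bool" where
  "chart_derivative f F x \<longleftrightarrow>
    (\<forall>\<^sub>F y in nhds x. f y \<in> U) \<and> ((\<lambda>y. \<phi> (f y)) has_derivative F) (at x)"

lemma chart_derivative_in: "chart_derivative f F x \<Longrightarrow> f x \<in> U"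
  unfolding chart_derivative_def by (auto dest: eventually_nhds_x_imp_x)

lemma chart_derivative_cong:
  assumes f: "chart_derivative f F x" and fg: "\<forall>\<^sub>F y in nhds x. f y = g y"
  shows "chart_derivative g F x"
  unfolding chart_derivative_def
proof
  show "\<forall>\<^sub>F y in nhds x. g y \<in> U"
    using f fg unfolding chart_derivative_def by (auto elim: eventually_elim2)
  have "\<forall>\<^sub>F y in nhds x. \<phi> (f y) = \<phi> (g y)"
    using fg by eventually_elim simp
  then show "((\<lambda>y. \<phi> (g y)) has_derivative F) (at x)"
    using f unfolding chart_derivative_def by (blast intro: has_derivative_transform_nhds)
qed

lemma chart_derivative_unique:
  assumes "chart_derivative f F x" "chart_derivative f F' x"
  shows "F = F'"
  using assms unfolding chart_derivative_def by (auto intro: has_derivative_unique)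

lemma chart_derivative_const: "g \<in> U \<Longrightarrow> chart_derivative (\<lambda>_. g) (\<lambda>_. 0) x"
  by (simp add: chart_derivative_def)

lemma chart_derivative_psi_comp:
  assumes f: "(f has_derivative F) (at x)" and x: "f x \<in> E"
  shows "chart_derivative (\<lambda>y. \<psi> (f y)) F x"
proof -
  note ev = eventually_nhds_preimage[OF f chart_props(2) x]
  have "\<forall>\<^sub>F y in nhds x. f y = \<phi> (\<psi> (f y))"
    using ev by eventually_elim (simp add: phi_psi)
  then have "((\<lambda>y. \<phi> (\<psi> (f y))) has_derivative F) (at x)"
    by (rule has_derivative_transform_nhds[OF f])
  moreover have "\<forall>\<^sub>F y in nhds x. \<psi> (f y) \<in> U"
    using ev by eventually_elim (simp add: psi_in)
  ultimately show ?thesis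
    by (simp add: chart_derivative_def)
qed

lemma chart_derivative_psi: "x \<in> E \<Longrightarrow> chart_derivative \<psi> (\<lambda>k. k) x"
  using chart_derivative_psi_comp[OF has_derivative_ident] by simp

text \<open>The chain rule for \<open>mult\<close>. The product has to lie in \<open>U\<close> at
  \<open>x\<close> itself; openness of \<open>mult_dom\<close> extends this to nearby
  points.\<close>

lemma chart_derivative_mult:
  assumes f: "chart_derivative f F x" and h: "chart_derivative h H x" and fh: "f x \<otimes> h x \<in> U"
  shows "chart_derivative (\<lambda>y. f y \<otimes> h y) (\<lambda>k. Dmult (\<phi> (f x), \<phi> (h x)) (F k, H k)) x"
proof -
  let ?p = "\<lambda>y. (\<phi> (f y), \<phi> (h y))"
  have p: "(?p has_derivative (\<lambda>k. (F k, H k))) (at x)"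
    using f h unfolding chart_derivative_def by (auto intro: has_derivative_Pair)
  have px: "?p x \<in> mult_dom"
    using fh chart_derivative_in[OF f] chart_derivative_in[OF h]
    by (simp add: mult_dom_def phi_in psi_phi)
  have "\<forall>\<^sub>F y in nhds x. ?p y \<in> mult_dom"
    using eventually_nhds_preimage[OF p open_mult_dom px] .
  moreover have "\<forall>\<^sub>F y in nhds x. f y \<in> U" "\<forall>\<^sub>F y in nhds x. h y \<in> U"
    using f h by (auto simp: chart_derivative_def)
  ultimately have ev: "\<forall>\<^sub>F y in nhds x. f y \<otimes> h y \<in> U" "\<forall>\<^sub>F y in nhds x. mult (?p y) = \<phi> (f y \<otimes> h y)"
    by (eventually_elim; simp add: mult_dom_def mult_def psi_phi)+
  have "((\<lambda>y. mult (?p y)) has_derivative (\<lambda>k. Dmult (?p x) (F k, H k))) (at x)"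
    using has_derivative_compose[OF p mult_has_derivative[OF px]] .
  then have "((\<lambda>y. \<phi> (f y \<otimes> h y)) has_derivative (\<lambda>k. Dmult (?p x) (F k, H k))) (at x)"
    by (rule has_derivative_transform_nhds[OF _ ev(2)])
  then show ?thesis
    using ev(1) by (simp add: chart_derivative_def)
qed

lemma chart_derivative_inv:
  assumes f: "chart_derivative f F x" and fx: "inv (f x) \<in> U"
  shows "chart_derivative (\<lambda>y. inv (f y)) (\<lambda>k. frechet_derivative minv (at (\<phi> (f x))) (F k)) x"
proof -
  let ?p = "\<lambda>y. \<phi> (f y)"
  have p: "(?p has_derivative F) (at x)"
    using f unfolding chart_derivative_def by auto
  have px: "?p x \<in> minv_dom"
    using fx chart_derivative_in[OF f] by (simp add: minv_dom_def phi_in psi_phi)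
  have "\<forall>\<^sub>F y in nhds x. ?p y \<in> minv_dom"
    using eventually_nhds_preimage[OF p open_minv_dom px] .
  moreover have "\<forall>\<^sub>F y in nhds x. f y \<in> U"
    using f by (auto simp: chart_derivative_def)
  ultimately have ev: "\<forall>\<^sub>F y in nhds x. inv (f y) \<in> U" "\<forall>\<^sub>F y in nhds x. minv (?p y) = \<phi> (inv (f y))"
    by (eventually_elim; simp add: minv_dom_def minv_def psi_phi)+
  have "((\<lambda>y. minv (?p y)) has_derivative (\<lambda>k. frechet_derivative minv (at (?p x)) (F k))) (at x)"
    using has_derivative_compose[OF p Ck_on_Suc_differentiable[OF smooth_minv px]] .
  then have "((\<lambda>y. \<phi> (inv (f y))) has_derivative (\<lambda>k. frechet_derivative minv (at (?p x)) (F k))) (at x)"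
    by (rule has_derivative_transform_nhds[OF _ ev(2)])
  then show ?thesis
    using ev(1) by (simp add: chart_derivative_def)
qed

section \<open>First derivatives of the group operations at the identity\<close>

lemma in_mult_dom: "x \<in> E \<Longrightarrow> (x, e) \<in> mult_dom" "x \<in> E \<Longrightarrow> (e, x) \<in> mult_dom"
  by (auto simp: mult_dom_def e_in psi_e psi_in psi_carrier)

text \<open>Differentiating the right unit law. The chart need not be centred, so the identity has
  coordinate \<open>e\<close>.\<close>

lemma Dmult_e_right: "Dmult (x, e) (u, 0) = u" if "x \<in> E"
proof -
  have "chart_derivative (\<lambda>y. \<psi> y \<otimes> \<one>) (\<lambda>k. Dmult (\<phi> (\<psi> x), \<phi> \<one>) (k, 0)) x"
    using that by (intro chart_derivative_mult chart_derivative_psi chart_derivative_const one_in)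
      (auto simp: psi_in psi_carrier)
  moreover have "\<forall>\<^sub>F y in nhds x. \<psi> y \<otimes> \<one> = \<psi> y"
    using eventually_nhds_in_open[OF chart_props(2) that] by eventually_elim (simp add: psi_carrier)
  ultimately have "chart_derivative \<psi> (\<lambda>k. Dmult (x, e) (k, 0)) x"
    using that by (auto simp: phi_psi e_def intro: chart_derivative_cong)
  then show ?thesis
    using chart_derivative_unique[OF _ chart_derivative_psi[OF that]] by metis
qed

lemma Dmult_e_left: "Dmult (e, x) (0, u) = u" if "x \<in> E"
proof -
  have "chart_derivative (\<lambda>y. \<one> \<otimes> \<psi> y) (\<lambda>k. Dmult (\<phi> \<one>, \<phi> (\<psi> x)) (0, k)) x"
    using that by (intro chart_derivative_mult chart_derivative_psi chart_derivative_const one_in)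
      (auto simp: psi_in psi_carrier)
  moreover have "\<forall>\<^sub>F y in nhds x. \<one> \<otimes> \<psi> y = \<psi> y"
    using eventually_nhds_in_open[OF chart_props(2) that] by eventually_elim (simp add: psi_carrier)
  ultimately have "chart_derivative \<psi> (\<lambda>k. Dmult (e, x) (0, k)) x"
    using that by (auto simp: phi_psi e_def intro: chart_derivative_cong)
  then show ?thesis
    using chart_derivative_unique[OF _ chart_derivative_psi[OF that]] by metis
qed

lemma Dmult_e_e: "Dmult (e, e) (u, v) = u + v"
  using linear_add[OF linear_Dmult[OF in_mult_dom(1)[OF e_in]], of "(u, 0)" "(0, v)"]
  by (simp add: Dmult_e_left Dmult_e_right e_in)

text \<open>Differentiating y y^-1 = 1 at the identity, where the derivative of the product is the
  sum of the derivatives.\<close>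

lemma minv_derivative_e: "frechet_derivative minv (at e) u = - u"
proof -
  have "chart_derivative (\<lambda>y. \<psi> y \<otimes> inv (\<psi> y))
      (\<lambda>k. Dmult (\<phi> (\<psi> e), \<phi> (inv (\<psi> e))) (k, frechet_derivative minv (at (\<phi> (\<psi> e))) k)) e"
    by (intro chart_derivative_mult chart_derivative_inv chart_derivative_psi e_in)
      (auto simp: psi_e one_in)
  moreover have "\<forall>\<^sub>F y in nhds e. \<psi> y \<otimes> inv (\<psi> y) = \<one>"
    using eventually_nhds_in_open[OF chart_props(2) e_in] by eventually_elim (simp add: psi_carrier)
  ultimately have "chart_derivative (\<lambda>_. \<one>) (\<lambda>k. k + frechet_derivative minv (at e) k) e"
    by (auto simp: psi_e e_def[symmetric] Dmult_e_e intro: chart_derivative_cong)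
  from chart_derivative_unique[OF this chart_derivative_const[OF one_in]]
  have "u + frechet_derivative minv (at e) u = 0"
    by (rule fun_cong)
  then show ?thesis
    by (simp add: eq_neg_iff_add_eq_0 add.commute)
qed

section \<open>The second derivative of the multiplication and the Lie bracket\<close>

definition D2mult :: "'e \<times> 'e \<Rightarrow> 'e \<times> 'e \<Rightarrow> 'e \<times> 'e \<Rightarrow> 'e" where
  "D2mult p v w = frechet_derivative (\<lambda>q. Dmult q v) (at p) w"

lemma Dmult_has_derivative:
  "p \<in> mult_dom \<Longrightarrow> ((\<lambda>q. Dmult q v) has_derivative D2mult p v) (at p)"
  using Ck_on_Suc_differentiable[OF Ck_on_frechet_derivative[OF smooth_mult]]
  unfolding D2mult_def by auto

lemma D2mult_commute: "p \<in> mult_dom \<Longrightarrow> D2mult p v w = D2mult p w v"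
  unfolding D2mult_def by (rule frechet_derivative_commute[OF smooth_mult open_mult_dom])

text \<open>The bilinear second-order term of the group law at the identity; its antisymmetrisation
  is the bracket.\<close>

definition mixed :: "'e \<Rightarrow> 'e \<Rightarrow> 'e" where
  "mixed u v = D2mult (e, e) (u, 0) (0, v)"

text \<open>Differentiating a left-invariant field takes the two directions in the opposite order
  from \<open>mixed\<close>, so symmetry of second derivatives enters here.\<close>

lemma left_field_has_derivative:
  "((\<lambda>x. Dmult (x, e) (0, v)) has_derivative (\<lambda>u. mixed u v)) (at e)"
proof -
  have "((\<lambda>x. (x, e)) has_derivative (\<lambda>u. (u, 0))) (at e)"
    by (intro has_derivative_Pair has_derivative_ident has_derivative_const)
  from has_derivative_compose[OF this, where g = "\<lambda>q. Dmult q (0, v)",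
      OF Dmult_has_derivative[OF in_mult_dom(1)[OF e_in]]]
  show ?thesis
    by (simp add: mixed_def D2mult_commute[OF in_mult_dom(1)[OF e_in], of "(0, v)"])
qed

lemma right_field_has_derivative:
  "((\<lambda>x. Dmult (e, x) (u, 0)) has_derivative (\<lambda>v. mixed u v)) (at e)"
proof -
  have "((\<lambda>x. (e, x)) has_derivative (\<lambda>u. (0, u))) (at e)"
    by (intro has_derivative_Pair has_derivative_ident has_derivative_const)
  from has_derivative_compose[OF this, where g = "\<lambda>q. Dmult q (u, 0)",
      OF Dmult_has_derivative[OF in_mult_dom(1)[OF e_in]]]
  show ?thesis
    by (simp add: mixed_def)
qed

lemma linear_mixed_right: "linear (mixed u)"
  using right_field_has_derivative has_derivative_linear by blast

lemma linear_mixed_left: "linear (\<lambda>u. mixed u v)"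
  using left_field_has_derivative has_derivative_linear by blast

lemma left_invariant_field_eq:
  assumes "x \<in> E"
  shows "left_invariant_field G (U, \<phi>) v x = Dmult (x, e) (0, v)"
proof -
  have "chart_derivative (\<lambda>y. \<psi> x \<otimes> \<psi> y) (\<lambda>k. Dmult (\<phi> (\<psi> x), \<phi> (\<psi> e)) (0, k)) e"
    using assms by (intro chart_derivative_mult chart_derivative_psi chart_derivative_const)
      (auto simp: psi_in psi_carrier psi_e e_in)
  then have "((\<lambda>y. \<phi> (\<psi> x \<otimes> \<psi> y)) has_derivative (\<lambda>k. Dmult (x, e) (0, k))) (at e)"
    using assms by (simp add: chart_derivative_def phi_psi e_in)
  from fun_cong[OF frechet_derivative_at[OF this], of v] show ?thesis
    by (simp add: left_invariant_field_def \<psi>_def e_def)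
qed

text \<open>By the unit law the two fields take the values \<open>u\<close> and \<open>v\<close> at
  \<open>e\<close>, so each directional derivative in the commutator is one value of
  \<open>mixed\<close>.\<close>

lemma lie_bracket_eq: "lie_bracket G (U, \<phi>) u v = mixed u v - mixed v u"
proof -
  have "frechet_derivative (left_invariant_field G (U, \<phi>) v) (at e) = (\<lambda>u. mixed u v)" for v
  proof (rule frechet_derivative_at[symmetric], rule has_derivative_transform_nhds[OF left_field_has_derivative])
    show "\<forall>\<^sub>F x in nhds e. Dmult (x, e) (0, v) = left_invariant_field G (U, \<phi>) v x"
      using eventually_nhds_in_open[OF chart_props(2) e_in]
      by eventually_elim (simp add: left_invariant_field_eq)
  qed
  then show ?thesis
    by (simp add: lie_bracket_def Let_def e_def[symmetric] left_invariant_field_eq e_in Dmult_e_left)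
qed

lemma linear_lie_bracket: "linear (lie_bracket G (U, \<phi>) u)"
  unfolding lie_bracket_eq[abs_def]
  by (intro linear_compose_sub linear_mixed_right linear_mixed_left)

lemma lie_bracket_skew: "lie_bracket G (U, \<phi>) u v = - lie_bracket G (U, \<phi>) v u"
  by (simp add: lie_bracket_eq)

text \<open>The adjoint representation in the chart: the derivative of \<open>y \<mapsto> x y x\<^sup>-\<^sup>1\<close> at the identity.\<close>

definition Ad :: "'e \<Rightarrow> 'e \<Rightarrow> 'e" where
  "Ad x v = Dmult (x, minv x) (Dmult (x, e) (0, v), 0)"

text \<open>This identifies the coordinate formula \<open>Ad\<close> as the derivative of
  conjugation, along any map that passes through the identity at \<open>x\<close>.\<close>

lemma chart_derivative_conj:
  assumes g: "g \<in> U" "inv g \<in> U" and f: "chart_derivative f F x" "f x = \<one>"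
  shows "chart_derivative (\<lambda>y. g \<otimes> f y \<otimes> inv g) (\<lambda>k. Ad (\<phi> g) (F k)) x"
proof -
  have "chart_derivative (\<lambda>y. g \<otimes> f y) (\<lambda>k. Dmult (\<phi> g, \<phi> (f x)) (0, F k)) x"
    using g f(2) by (intro chart_derivative_mult chart_derivative_const f(1)) (auto simp: U_carrier)
  then have "chart_derivative (\<lambda>y. g \<otimes> f y \<otimes> inv g)
      (\<lambda>k. Dmult (\<phi> (g \<otimes> f x), \<phi> (inv g)) (Dmult (\<phi> g, \<phi> (f x)) (0, F k), 0)) x"
    using g f(2) by (intro chart_derivative_mult[OF _ chart_derivative_const]) (auto simp: U_carrier one_in)
  then show ?thesis
    using g f(2) by (simp add: Ad_def minv_def psi_phi U_carrier e_def)
qed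

lemma minv_e: "minv e = e"
  by (simp add: minv_def psi_e flip: e_def)

lemma e_in_minv_dom: "e \<in> minv_dom"
  by (simp add: minv_dom_def e_in psi_e one_in)

lemma in_mult_dom_minv: "x \<in> minv_dom \<Longrightarrow> (x, minv x) \<in> mult_dom"
  by (simp add: mult_dom_def minv_dom_def minv_def phi_in psi_phi psi_carrier one_in)

lemma Ad_e: "Ad e v = v"
  by (simp add: Ad_def minv_e Dmult_e_left Dmult_e_right e_in)

lemma linear_Ad: "x \<in> minv_dom \<Longrightarrow> linear (Ad x)"
proof -
  assume x: "x \<in> minv_dom"
  then have xE: "x \<in> E" by (simp add: minv_dom_def)
  have 1: "linear (\<lambda>v. Dmult (x, e) (0, v))"
    using linear_compose[OF _ linear_Dmult[OF in_mult_dom(1)[OF xE]], of "\<lambda>v. (0, v)"]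
    by (simp add: o_def linear_pair_zero linear_zero_pair)
  have 2: "linear (\<lambda>v. Dmult (x, minv x) (v, 0))"
    using linear_compose[OF _ linear_Dmult[OF in_mult_dom_minv[OF x]], of "\<lambda>v. (v, 0)"]
    by (simp add: o_def linear_pair_zero linear_zero_pair)
  show ?thesis
    using linear_compose[OF 1 2] by (simp add: o_def Ad_def[abs_def])
qed

text \<open>Conjugation by a product is the composite of the conjugations, and derivatives are
  unique. The memberships keep all the elements involved inside the single chart.\<close>

lemma Ad_mult:
  assumes g: "g \<in> U" "inv g \<in> U" and h: "h \<in> U" "inv h \<in> U" and gh: "g \<otimes> h \<in> U" "inv (g \<otimes> h) \<in> U"
  shows "Ad (\<phi> (g \<otimes> h)) v = Ad (\<phi> g) (Ad (\<phi> h) v)"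
proof -
  note c = U_carrier[OF g(1)] U_carrier[OF h(1)]
  have 1: "chart_derivative (\<lambda>y. g \<otimes> h \<otimes> \<psi> y \<otimes> inv (g \<otimes> h)) (\<lambda>k. Ad (\<phi> (g \<otimes> h)) k) e"
    by (rule chart_derivative_conj[OF gh chart_derivative_psi[OF e_in] psi_e])
  have 2: "chart_derivative (\<lambda>y. g \<otimes> (h \<otimes> \<psi> y \<otimes> inv h) \<otimes> inv g) (\<lambda>k. Ad (\<phi> g) (Ad (\<phi> h) k)) e"
    using c by (intro chart_derivative_conj[OF g] chart_derivative_conj[OF h chart_derivative_psi[OF e_in] psi_e])
      (simp add: psi_e)
  have "\<forall>\<^sub>F y in nhds e. g \<otimes> (h \<otimes> \<psi> y \<otimes> inv h) \<otimes> inv g = g \<otimes> h \<otimes> \<psi> y \<otimes> inv (g \<otimes> h)"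
    using eventually_nhds_in_open[OF chart_props(2) e_in]
    by eventually_elim (simp add: psi_carrier c m_assoc inv_mult_group)
  from chart_derivative_unique[OF 1 chart_derivative_cong[OF 2 this]] show ?thesis
    by metis
qed

text \<open>The derivative in y of (x y x^-1) x = x y. It relates \<open>Ad\<close> to the
  left-invariant field without mentioning \<open>minv\<close>.\<close>

lemma Dmult_Ad:
  assumes x: "x \<in> minv_dom"
  shows "Dmult (e, x) (Ad x v, 0) = Dmult (x, e) (0, v)"
proof -
  have xE: "x \<in> E" and xU: "\<psi> x \<in> U" "inv (\<psi> x) \<in> U"
    using x by (auto simp: minv_dom_def psi_in)
  have xc: "\<psi> x \<in> carrier G"
    using xU U_carrier by blast
  have "chart_derivative (\<lambda>y. \<psi> x \<otimes> \<psi> y \<otimes> inv (\<psi> x)) (\<lambda>k. Ad x k) e"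
    using chart_derivative_conj[OF xU chart_derivative_psi[OF e_in] psi_e] by (simp add: phi_psi xE)
  then have "chart_derivative (\<lambda>y. \<psi> x \<otimes> \<psi> y \<otimes> inv (\<psi> x) \<otimes> \<psi> x)
      (\<lambda>k. Dmult (\<phi> (\<psi> x \<otimes> \<psi> e \<otimes> inv (\<psi> x)), \<phi> (\<psi> x)) (Ad x k, 0)) e"
    using xU xc by (intro chart_derivative_mult chart_derivative_const) (auto simp: psi_e)
  then have 1: "chart_derivative (\<lambda>y. \<psi> x \<otimes> \<psi> y \<otimes> inv (\<psi> x) \<otimes> \<psi> x) (\<lambda>k. Dmult (e, x) (Ad x k, 0)) e"
    using xc xE by (simp add: psi_e phi_psi flip: e_def)
  have "chart_derivative (\<lambda>y. \<psi> x \<otimes> \<psi> y) (\<lambda>k. Dmult (\<phi> (\<psi> x), \<phi> (\<psi> e)) (0, k)) e"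
    using xU xc by (intro chart_derivative_mult chart_derivative_const chart_derivative_psi e_in) (auto simp: psi_e)
  then have 2: "chart_derivative (\<lambda>y. \<psi> x \<otimes> \<psi> y) (\<lambda>k. Dmult (x, e) (0, k)) e"
    by (simp add: phi_psi xE e_in)
  have "\<forall>\<^sub>F y in nhds e. \<psi> x \<otimes> \<psi> y \<otimes> inv (\<psi> x) \<otimes> \<psi> x = \<psi> x \<otimes> \<psi> y"
    using eventually_nhds_in_open[OF chart_props(2) e_in]
    by eventually_elim (simp add: psi_carrier xc m_assoc)
  from chart_derivative_unique[OF chart_derivative_cong[OF 1 this] 2] show ?thesis
    by metis
qed

text \<open>\<open>Ad x v\<close> is a linear family applied to a differentiable argument. The
  formula obtained involves the derivative of \<open>minv\<close> and is discarded; only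
  differentiability is kept.\<close>

lemma Ad_differentiable: "(\<lambda>x. Ad x v) differentiable (at e)"
proof -
  have p: "((\<lambda>x. (x, minv x)) has_derivative (\<lambda>k. (k, frechet_derivative minv (at e) k))) (at e)"
    by (intro has_derivative_Pair has_derivative_ident Ck_on_Suc_differentiable[OF smooth_minv e_in_minv_dom])
  have ev: "\<forall>\<^sub>F x in nhds e. (x, minv x) \<in> mult_dom"
    using eventually_nhds_in_open[OF open_minv_dom e_in_minv_dom]
    by eventually_elim (rule in_mult_dom_minv)
  have "\<forall>\<^sub>F x in nhds e. linear (\<lambda>w. Dmult (x, minv x) w)"
    using ev by eventually_elim (rule linear_Dmult)
  moreover have "((\<lambda>x. Dmult (x, minv x) w) has_derivative
      (\<lambda>k. D2mult (e, minv e) w (k, frechet_derivative minv (at e) k))) (at e)" for w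
    by (rule has_derivative_compose[OF p, where g = "\<lambda>q. Dmult q w"])
      (rule Dmult_has_derivative[OF in_mult_dom_minv[OF e_in_minv_dom]])
  moreover have "((\<lambda>x. (Dmult (x, e) (0, v), 0::'e)) has_derivative (\<lambda>u. (mixed u v, 0))) (at e)"
    by (intro has_derivative_Pair left_field_has_derivative has_derivative_const)
  ultimately have "((\<lambda>x. Dmult (x, minv x) (Dmult (x, e) (0, v), 0)) has_derivative
     (\<lambda>h. D2mult (e, minv e) (Dmult (e, e) (0, v), 0) (h, frechet_derivative minv (at e) h) +
          Dmult (e, minv e) (mixed h v, 0))) (at e)"
    by (rule has_derivative_linear_family_apply)
  then show ?thesis
    unfolding Ad_def differentiable_def by blast
qed

text \<open>Obtained by differentiating \<open>Dmult_Ad\<close> in \<open>x\<close> at the identity.\<close>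

lemma Ad_has_derivative:
  "((\<lambda>x. Ad x v) has_derivative (\<lambda>u. lie_bracket G (U, \<phi>) u v)) (at e)"
proof -
  obtain A where A: "((\<lambda>x. Ad x v) has_derivative A) (at e)"
    using Ad_differentiable differentiable_def by blast
  have evE: "\<forall>\<^sub>F x in nhds e. x \<in> E"
    by (rule eventually_nhds_in_open[OF chart_props(2) e_in])
  have "\<forall>\<^sub>F x in nhds e. linear (\<lambda>w. Dmult (e, x) (w, 0))"
    using evE
  proof eventually_elim
    case (elim x)
    show ?case
      using linear_compose[OF _ linear_Dmult[OF in_mult_dom(2)[OF elim]], of "\<lambda>v. (v, 0)"]
      by (simp add: o_def linear_pair_zero linear_zero_pair)
  qed
  then have "((\<lambda>x. Dmult (e, x) (Ad x v, 0)) has_derivative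
      (\<lambda>u. mixed (Ad e v) u + Dmult (e, e) (A u, 0))) (at e)"
    by (rule has_derivative_linear_family_apply[OF _ right_field_has_derivative A])
  then have 1: "((\<lambda>x. Dmult (e, x) (Ad x v, 0)) has_derivative (\<lambda>u. mixed v u + A u)) (at e)"
    by (simp add: Ad_e Dmult_e_right e_in)
  have 2: "\<forall>\<^sub>F x in nhds e. Dmult (e, x) (Ad x v, 0) = Dmult (x, e) (0, v)"
    using eventually_nhds_in_open[OF open_minv_dom e_in_minv_dom]
    by eventually_elim (rule Dmult_Ad)
  \<comment> \<open>Both sides of \<open>Dmult_Ad\<close> have now been differentiated, and solving
    for \<open>A\<close> gives the bracket.\<close>
  have "(\<lambda>u. mixed v u + A u) = (\<lambda>u. mixed u v)"
    by (rule has_derivative_unique[OF has_derivative_transform_nhds[OF 1 2] left_field_has_derivative])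
  then have "mixed v u + A u = mixed u v" for u
    by (rule fun_cong)
  then have "A = (\<lambda>u. lie_bracket G (U, \<phi>) u v)"
    by (simp add: fun_eq_iff lie_bracket_eq algebra_simps)
  with A show ?thesis by simp
qed

text \<open>Near \<open>x\<close>, \<open>Ad y\<close> is \<open>Ad x\<close> composed with
  \<open>Ad\<close> of x^-1 y. The latter element is the identity at y = x, so the chain rule
  transports the vanishing derivative from \<open>e\<close> to \<open>x\<close>.\<close>

lemma Ad_derivative_zero:
  assumes ad: "\<And>u v. lie_bracket G (U, \<phi>) u v = 0" and x: "x \<in> minv_dom"
  shows "((\<lambda>y. Ad y v) has_derivative (\<lambda>_. 0)) (at x)"
proof -
  have xE: "x \<in> E" and xU: "\<psi> x \<in> U" "inv (\<psi> x) \<in> U"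
    using x by (auto simp: minv_dom_def psi_in)
  have xc: "\<psi> x \<in> carrier G"
    using xU U_carrier by blast
  define k where "k y = inv (\<psi> x) \<otimes> \<psi> y" for y
  have kx: "k x = \<one>"
    using xc by (simp add: k_def)
  obtain K where K: "chart_derivative k K x"
    using chart_derivative_mult[OF chart_derivative_const[OF xU(2)] chart_derivative_psi[OF xE]] kx one_in
    unfolding k_def[abs_def] by force
  have "((\<lambda>y. Ad y v) has_derivative (\<lambda>_. 0)) (at (\<phi> (k x)))"
    using Ad_has_derivative[of v] by (simp add: kx ad flip: e_def)
  then have "((\<lambda>y. Ad (\<phi> (k y)) v) has_derivative (\<lambda>_. 0)) (at x)"
    using has_derivative_compose[of "\<lambda>y. \<phi> (k y)" K x UNIV "\<lambda>y. Ad y v" "\<lambda>_. 0"] K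
    by (simp add: chart_derivative_def)
  then have "((\<lambda>y. Ad x (Ad (\<phi> (k y)) v)) has_derivative (\<lambda>_. Ad x 0)) (at x)"
    by (rule bounded_linear.has_derivative[OF linear_Ad[OF x, unfolded linear_conv_bounded_linear]])
  then have 1: "((\<lambda>y. Ad x (Ad (\<phi> (k y)) v)) has_derivative (\<lambda>_. 0)) (at x)"
    by (simp add: linear_0[OF linear_Ad[OF x]])
  have "\<forall>\<^sub>F y in nhds x. k y \<in> U" "\<forall>\<^sub>F y in nhds x. inv (k y) \<in> U"
    using K chart_derivative_inv[OF K] kx one_in by (auto simp: chart_derivative_def)
  moreover have "\<forall>\<^sub>F y in nhds x. y \<in> minv_dom"
    by (rule eventually_nhds_in_open[OF open_minv_dom x])
  ultimately have "\<forall>\<^sub>F y in nhds x. Ad x (Ad (\<phi> (k y)) v) = Ad y v"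
  proof eventually_elim
    case (elim y)
    have yE: "y \<in> E" and yU: "\<psi> y \<in> U" "inv (\<psi> y) \<in> U"
      using elim by (auto simp: minv_dom_def psi_in)
    have xk: "\<psi> x \<otimes> k y = \<psi> y"
      using xc yU(1) U_carrier by (simp add: k_def m_assoc[symmetric])
    show ?case
      using Ad_mult[OF xU elim(1,2), of v] yU xE yE by (simp add: xk phi_psi)
  qed
  from has_derivative_transform_nhds[OF 1 this] show ?thesis .
qed

lemma Ad_trivial:
  assumes ad: "\<And>u v. lie_bracket G (U, \<phi>) u v = 0" and r: "ball e r \<subseteq> minv_dom" "x \<in> ball e r"
  shows "Ad x v = v"
proof -
  have "e \<in> ball e r"
    using r(2) by (auto intro: le_less_trans[OF zero_le_dist])
  then have "Ad x v = Ad e v"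
    using has_derivative_zero_unique_connected[OF open_ball connected_ball, of e r "\<lambda>y. Ad y v" x e]
      Ad_derivative_zero[OF ad] r by blast
  then show ?thesis by (simp add: Ad_e)
qed

text \<open>The commutator \<open>y \<mapsto> g y g\<^sup>-\<^sup>1 y\<^sup>-\<^sup>1\<close> has derivative zero at the identity, and, writing
  \<open>y' = y k\<close>, it is \<open>(g y g\<^sup>-\<^sup>1) (g k g\<^sup>-\<^sup>1 k\<^sup>-\<^sup>1) y\<^sup>-\<^sup>1\<close>, so its derivative vanishes at all \<open>y\<close>.\<close>

lemma commutator_derivative_zero:
  assumes g: "g \<in> U" "inv g \<in> U" and Ad: "\<And>v. Ad (\<phi> g) v = v" and y: "y \<in> minv_dom"
    and conj: "g \<otimes> \<psi> y \<otimes> inv g \<in> U" and comm: "g \<otimes> \<psi> y \<otimes> inv g \<otimes> inv (\<psi> y) \<in> U"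
  shows "((\<lambda>z. \<phi> (g \<otimes> \<psi> z \<otimes> inv g \<otimes> inv (\<psi> z))) has_derivative (\<lambda>_. 0)) (at y)"
proof -
  have yE: "y \<in> E" and yU: "\<psi> y \<in> U" "inv (\<psi> y) \<in> U"
    using y by (auto simp: minv_dom_def psi_in)
  have yc: "\<psi> y \<in> carrier G" and gc: "g \<in> carrier G"
    using yU g U_carrier by blast+
  define k where "k z = inv (\<psi> y) \<otimes> \<psi> z" for z
  have ky: "k y = \<one>"
    using yc by (simp add: k_def)
  obtain K where K: "chart_derivative k K y"
    using chart_derivative_mult[OF chart_derivative_const[OF yU(2)] chart_derivative_psi[OF yE]] ky one_in
    unfolding k_def[abs_def] by force
  \<comment> \<open>As \<open>Ad\<close> of \<open>g\<close> is trivial, conjugation by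
    \<open>g\<close> leaves the derivative \<open>K\<close> unchanged. The inverse of
    \<open>k\<close> contributes its negative, and the two cancel by
    \<open>Dmult_e_e\<close>.\<close>
  have "chart_derivative (\<lambda>z. g \<otimes> k z \<otimes> inv g) K y"
    using chart_derivative_conj[OF g K ky] by (simp add: Ad)
  moreover have "chart_derivative (\<lambda>z. inv (k z)) (\<lambda>h. - K h) y"
    using chart_derivative_inv[OF K] ky one_in by (simp add: minv_derivative_e flip: e_def)
  ultimately have "chart_derivative (\<lambda>z. g \<otimes> k z \<otimes> inv g \<otimes> inv (k z))
      (\<lambda>h. Dmult (\<phi> (g \<otimes> k y \<otimes> inv g), \<phi> (inv (k y))) (K h, - K h)) y"
    by (rule chart_derivative_mult) (simp add: ky gc one_in)
  then have "chart_derivative (\<lambda>z. g \<otimes> k z \<otimes> inv g \<otimes> inv (k z)) (\<lambda>_. 0) y"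
    by (simp add: ky gc Dmult_e_e flip: e_def)
  from chart_derivative_mult[OF chart_derivative_const[OF conj] this]
  have "chart_derivative (\<lambda>z. g \<otimes> \<psi> y \<otimes> inv g \<otimes> (g \<otimes> k z \<otimes> inv g \<otimes> inv (k z)))
      (\<lambda>_. Dmult (\<phi> (g \<otimes> \<psi> y \<otimes> inv g), e) (0, 0)) y"
    using conj by (simp add: ky gc yc flip: e_def)
  then have "chart_derivative (\<lambda>z. g \<otimes> \<psi> y \<otimes> inv g \<otimes> (g \<otimes> k z \<otimes> inv g \<otimes> inv (k z))) (\<lambda>_. 0) y"
    using linear_0[OF linear_Dmult[OF in_mult_dom(1)[OF phi_in[OF conj]]]] by (simp add: zero_prod_def)
  from chart_derivative_mult[OF this chart_derivative_const[OF yU(2)]]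
  have "chart_derivative (\<lambda>z. g \<otimes> \<psi> y \<otimes> inv g \<otimes> (g \<otimes> k z \<otimes> inv g \<otimes> inv (k z)) \<otimes> inv (\<psi> y))
      (\<lambda>_. Dmult (\<phi> (g \<otimes> \<psi> y \<otimes> inv g), \<phi> (inv (\<psi> y))) (0, 0)) y"
    using comm by (simp add: ky gc yc)
  moreover have "(\<phi> (g \<otimes> \<psi> y \<otimes> inv g), \<phi> (inv (\<psi> y))) \<in> mult_dom"
    using conj comm yU by (simp add: mult_dom_def phi_in psi_phi)
  ultimately have
    "chart_derivative (\<lambda>z. g \<otimes> \<psi> y \<otimes> inv g \<otimes> (g \<otimes> k z \<otimes> inv g \<otimes> inv (k z)) \<otimes> inv (\<psi> y)) (\<lambda>_. 0) y"
    using linear_0[OF linear_Dmult] by (simp add: zero_prod_def)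
  moreover have "\<forall>\<^sub>F z in nhds y. g \<otimes> \<psi> y \<otimes> inv g \<otimes> (g \<otimes> k z \<otimes> inv g \<otimes> inv (k z)) \<otimes> inv (\<psi> y) =
      g \<otimes> \<psi> z \<otimes> inv g \<otimes> inv (\<psi> z)"
    using eventually_nhds_in_open[OF chart_props(2) yE]
  proof eventually_elim
    case (elim z)
    have zc: "\<psi> z \<in> carrier G"
      using elim by (rule psi_carrier)
    have cancel: "inv g \<otimes> (g \<otimes> a) = a" "\<psi> y \<otimes> (inv (\<psi> y) \<otimes> a) = a" if "a \<in> carrier G" for a
      using that gc yc by (simp_all add: m_assoc[symmetric])
    show ?case
      using gc yc zc by (simp add: k_def inv_mult_group m_assoc cancel)
  qed
  ultimately have "chart_derivative (\<lambda>z. g \<otimes> \<psi> z \<otimes> inv g \<otimes> inv (\<psi> z)) (\<lambda>_. 0) y"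
    by (rule chart_derivative_cong)
  then show ?thesis
    by (simp add: chart_derivative_def)
qed

text \<open>For fixed x in a small ball, the commutator of x and y has zero derivative in y, so it
  is constant on the ball and equals its value at \<open>e\<close>, the identity.\<close>

lemma commuting_neighbourhood:
  assumes ad: "\<And>u v. lie_bracket G (U, \<phi>) u v = 0"
  shows "\<exists>W. openin T W \<and> \<one> \<in> W \<and> (\<forall>g\<in>W. \<forall>h\<in>W. g \<otimes> h = h \<otimes> g)"
proof -
  let ?c = "\<lambda>p. \<psi> (fst p) \<otimes> \<psi> (snd p) \<otimes> inv (\<psi> (fst p))"
  \<comment> \<open>Chart derivatives on the product space serve here to supply the memberships in
    \<open>U\<close> that hold for all pairs near \<open>(e, e)\<close>.\<close>
  have fst: "chart_derivative (\<lambda>p. \<psi> (fst p)) fst (e, e)" and snd: "chart_derivative (\<lambda>p. \<psi> (snd p)) snd (e, e)"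
    using chart_derivative_psi_comp[OF bounded_linear_imp_has_derivative[OF bounded_linear_fst], of "(e, e)"]
      chart_derivative_psi_comp[OF bounded_linear_imp_has_derivative[OF bounded_linear_snd], of "(e, e)"]
    by (simp_all add: e_in)
  note prod = chart_derivative_mult[OF fst snd]
  obtain C where C: "chart_derivative ?c C (e, e)"
    using chart_derivative_mult[OF prod chart_derivative_inv[OF fst]] by (auto simp: psi_e one_in)
  have ev1: "\<forall>\<^sub>F p in nhds (e, e). ?c p \<in> U"
    using C by (simp add: chart_derivative_def)
  have ev2: "\<forall>\<^sub>F p in nhds (e, e). ?c p \<otimes> inv (\<psi> (snd p)) \<in> U"
    using chart_derivative_mult[OF C chart_derivative_inv[OF snd]]
    by (simp add: psi_e one_in chart_derivative_def)
  have ev3: "\<forall>\<^sub>F p in nhds (e, e). p \<in> minv_dom \<times> minv_dom"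
    by (rule eventually_nhds_in_open) (auto intro: open_Times open_minv_dom e_in_minv_dom)
  have "\<forall>\<^sub>F p in nhds (e, e). p \<in> minv_dom \<times> minv_dom \<and> ?c p \<in> U \<and> ?c p \<otimes> inv (\<psi> (snd p)) \<in> U"
    using ev1 ev2 ev3 by eventually_elim blast
  then obtain S where S: "open S" "(e, e) \<in> S"
    "\<And>p. p \<in> S \<Longrightarrow> p \<in> minv_dom \<times> minv_dom \<and> ?c p \<in> U \<and> ?c p \<otimes> inv (\<psi> (snd p)) \<in> U"
    unfolding eventually_nhds by auto
  \<comment> \<open>A product neighbourhood yields one ball from which both variables can be taken
    independently.\<close>
  obtain A B where AB: "open A" "open B" "e \<in> A" "e \<in> B" "A \<times> B \<subseteq> S"
    by (rule open_prod_elim[OF S(1,2)]) (use that in auto)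
  obtain r where r: "r > 0" "ball e r \<subseteq> A \<inter> B"
    using openE[of "A \<inter> B" e] AB by blast
  have good: "x \<in> minv_dom" "y \<in> minv_dom" "\<psi> x \<otimes> \<psi> y \<otimes> inv (\<psi> x) \<in> U"
    "\<psi> x \<otimes> \<psi> y \<otimes> inv (\<psi> x) \<otimes> inv (\<psi> y) \<in> U"
    if "x \<in> ball e r" "y \<in> ball e r" for x y
  proof -
    have "(x, y) \<in> S"
      using that r(2) AB(5) by blast
    from S(3)[OF this] show "x \<in> minv_dom" "y \<in> minv_dom" "\<psi> x \<otimes> \<psi> y \<otimes> inv (\<psi> x) \<in> U"
      "\<psi> x \<otimes> \<psi> y \<otimes> inv (\<psi> x) \<otimes> inv (\<psi> y) \<in> U"
      by auto
  qed
  have commute: "\<psi> x \<otimes> \<psi> y = \<psi> y \<otimes> \<psi> x" if x: "x \<in> ball e r" and y: "y \<in> ball e r" for x y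
  proof -
    have e: "e \<in> ball e r"
      using r(1) by simp
    have xE: "x \<in> E" and xU: "\<psi> x \<in> U" "inv (\<psi> x) \<in> U" and yE: "y \<in> E"
      using good(1)[OF x y] good(2)[OF x y] by (auto simp: minv_dom_def psi_in)
    note xc = psi_carrier[OF xE] and yc = psi_carrier[OF yE]
    have "ball e r \<subseteq> minv_dom"
      using good(1)[OF _ e] by blast
    then have "Ad (\<phi> (\<psi> x)) v = v" for v
      using Ad_trivial[OF ad _ x] by (simp add: phi_psi xE)
    then have "((\<lambda>z. \<phi> (\<psi> x \<otimes> \<psi> z \<otimes> inv (\<psi> x) \<otimes> inv (\<psi> z))) has_derivative (\<lambda>_. 0)) (at z)"
      if "z \<in> ball e r" for z
      by (intro commutator_derivative_zero xU good[OF x that])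
    from has_derivative_zero_unique_connected[OF open_ball connected_ball this y e]
    have "\<phi> (\<psi> x \<otimes> \<psi> y \<otimes> inv (\<psi> x) \<otimes> inv (\<psi> y)) = \<phi> \<one>"
      using xc by (simp add: psi_e)
    then have "\<psi> x \<otimes> \<psi> y \<otimes> inv (\<psi> x) \<otimes> inv (\<psi> y) = \<one>"
      using inj_chart good(4)[OF x y] one_in by (auto dest: inj_onD)
    then have "\<psi> x \<otimes> \<psi> y \<otimes> inv (\<psi> x) \<otimes> inv (\<psi> y) \<otimes> (\<psi> y \<otimes> \<psi> x) = \<psi> y \<otimes> \<psi> x"
      using xc yc by simp
    moreover have "\<psi> x \<otimes> \<psi> y \<otimes> inv (\<psi> x) \<otimes> inv (\<psi> y) \<otimes> (\<psi> y \<otimes> \<psi> x) = \<psi> x \<otimes> \<psi> y"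
    proof -
      have "inv (\<psi> y) \<otimes> (\<psi> y \<otimes> \<psi> x) = \<psi> x"
        using xc yc by (simp add: m_assoc[symmetric])
      then show ?thesis
        using xc yc by (simp add: m_assoc)
    qed
    ultimately show ?thesis by simp
  qed
  define W where "W = {g \<in> U. \<phi> g \<in> ball e r}"
  have "continuous_map (subtopology T U) euclidean \<phi>"
    using homeomorphic_imp_continuous_map[OF chart_props(3)] continuous_map_into_fulltopology by blast
  from openin_continuous_map_preimage[OF this, of "ball e r"]
  have "openin (subtopology T U) {g \<in> topspace (subtopology T U). \<phi> g \<in> ball e r}"
    by simp
  moreover have "{g \<in> topspace (subtopology T U). \<phi> g \<in> ball e r} = W"
    using U_carrier topspace by (auto simp: W_def)
  ultimately have "openin T W"
    using openin_trans_full chart_props(1) by metis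
  moreover have "\<one> \<in> W"
    using one_in r(1) by (simp add: W_def flip: e_def)
  moreover have "g \<otimes> h = h \<otimes> g" if "g \<in> W" "h \<in> W" for g h
    using commute[of "\<phi> g" "\<phi> h"] that by (simp add: W_def psi_phi)
  ultimately show ?thesis by blast
qed

lemma lie_bracket_nonzero:
  assumes "nonabelian_lie_group G T"
  shows "\<exists>u v. lie_bracket G (U, \<phi>) u v \<noteq> 0"
  using assms commuting_neighbourhood identity_component_commutes
  unfolding nonabelian_lie_group_def by metis

end

section \<open>The octonionic equations\<close>

lemma oct_f_swap: "oct_f k j l = - oct_f k l j"
  by (simp add: oct_f_def)

text \<open>With \<open>X\<close> concentrated in component \<open>a\<close>, the two halves of the
  double sum agree, because both \<open>oct_f\<close> and the bracket change sign under exchange.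
  This absorbs the factor 1/2.\<close>

lemma oct_sum_single_generator:
  fixes br :: "'e::real_normed_vector \<Rightarrow> 'e \<Rightarrow> 'e"
  assumes lin: "\<And>u. linear (br u)" and skew: "\<And>u v. br u v = - br v u" and a: "a \<in> {1..7}"
  shows "(1/2) *\<^sub>R (\<Sum>j=1..7. \<Sum>l=1..7. oct_f k j l *\<^sub>R
      (br (if j = a then A else 0) (Y l) + br (Y j) (if l = a then A else 0))) =
    (\<Sum>l=1..7. oct_f k a l *\<^sub>R br A (Y l))"
proof -
  have br0: "br u 0 = 0" "br 0 u = 0" for u
    using linear_0[OF lin] skew[of 0 u] by auto
  have 1: "(\<Sum>j=1..7. \<Sum>l=1..7. oct_f k j l *\<^sub>R br (if j = a then A else 0) (Y l)) =
      (\<Sum>l=1..7. oct_f k a l *\<^sub>R br A (Y l))"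
  proof -
    have "(\<Sum>j=1..7. \<Sum>l=1..7. oct_f k j l *\<^sub>R br (if j = a then A else 0) (Y l)) =
        (\<Sum>j=1..7. if j = a then \<Sum>l=1..7. oct_f k a l *\<^sub>R br A (Y l) else 0)"
      by (intro sum.cong) (auto simp: br0)
    then show ?thesis
      using a by simp
  qed
  have 2: "(\<Sum>j=1..7. \<Sum>l=1..7. oct_f k j l *\<^sub>R br (Y j) (if l = a then A else 0)) =
      (\<Sum>l=1..7. oct_f k a l *\<^sub>R br A (Y l))"
  proof -
    have "(\<Sum>j=1..7. \<Sum>l=1..7. oct_f k j l *\<^sub>R br (Y j) (if l = a then A else 0)) =
        (\<Sum>j=1..7. \<Sum>l=1..7. if l = a then oct_f k j a *\<^sub>R br (Y j) A else 0)"
      by (intro sum.cong) (auto simp: br0)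
    also have "\<dots> = (\<Sum>j=1..7. oct_f k j a *\<^sub>R br (Y j) A)"
      using a by simp
    also have "\<dots> = (\<Sum>j=1..7. oct_f k a j *\<^sub>R br A (Y j))"
    proof (rule sum.cong)
      fix j
      show "oct_f k j a *\<^sub>R br (Y j) A = oct_f k a j *\<^sub>R br A (Y j)"
        by (subst oct_f_swap, subst skew) simp
    qed simp
    finally show ?thesis .
  qed
  show ?thesis
    unfolding scaleR_add_right sum.distrib 1 2 by (simp flip: scaleR_add_left)
qed

lemma ddt_eqI:
  fixes f :: "real \<Rightarrow> 'a::euclidean_space"
  assumes "(f has_vector_derivative f') (at t)" and "t \<in> {0..1}"
  shows "ddt f t = f'"
  using vector_derivative_within_closed_interval[OF zero_less_one assms(2)
      has_vector_derivative_at_within[OF assms(1)]] .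

text \<open>The indices are those of \<open>e\<^sub>q = \<plusminus> e\<^sub>p e\<^sub>a\<close>, \<open>e\<^sub>r = \<plusminus> e\<^sub>i e\<^sub>p\<close> and \<open>e\<^sub>s = \<plusminus> e\<^sub>i e\<^sub>q\<close>.\<close>

lemma cplx_struct_not_preserved_aux:
  fixes br :: "'e::euclidean_space \<Rightarrow> 'e \<Rightarrow> 'e"
  assumes lin: "\<And>u. linear (br u)" and skew: "\<And>u v. br u v = - br v u"
    and AB: "br A B \<noteq> 0"
    and idx: "a \<in> {1..7}" "p \<in> {1..7}" "q \<in> {1..7}" "r \<in> {1..7}" "s \<in> {1..7}"
    and dist: "a \<noteq> p" "a \<noteq> q" "p \<noteq> q" "s \<noteq> a"
    and fp: "\<And>k. k \<in> {1..7} \<Longrightarrow> oct_f k a p = (if k = q then - \<sigma> else 0)"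
    and fq: "\<And>k. k \<in> {1..7} \<Longrightarrow> oct_f k a q = (if k = p then \<sigma> else 0)"
    and fs: "\<And>l. l \<in> {1..7} \<Longrightarrow> oct_f s a l = (if l = r then \<omega> else 0)"
    and cr: "\<And>j. j \<in> {0..7} \<Longrightarrow> oct_coeff i j r = (if j = p then \<rho> else 0)"
    and cs: "\<And>j. j \<in> {0..7} \<Longrightarrow> oct_coeff i j s = (if j = q then \<tau> else 0)"
    and ne: "\<tau> * \<sigma> + \<omega> * \<rho> \<noteq> 0"
  shows "\<exists>X\<in>N_oct br. \<exists>Y\<in>tangent_M_oct br X. cplx_struct i Y \<notin> tangent_N_oct br X"
proof -
  have br0: "br u 0 = 0" "br 0 u = 0" for u
    using linear_0[OF lin] skew[of 0 u] by auto
  have blin: "bounded_linear (br A)"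
    using lin linear_conv_bounded_linear by blast
  note br_bl = bounded_linear.linear[OF blin]
  \<comment> \<open>By \<open>fp\<close> and \<open>fq\<close>, the tangent equations at
    \<open>X\<close> close up on components \<open>p\<close> and \<open>q\<close>, where they form
    the system y' = L y. The initial value \<open>(B, 0)\<close> places \<open>B\<close> in
    component \<open>p\<close>.\<close>
  define L where "L = (\<lambda>(u, v). (- \<sigma> *\<^sub>R br A v, \<sigma> *\<^sub>R br A u))"
  have "linear L"
    by (rule linearI) (auto simp: L_def linear_add[OF lin] linear_cmul[OF lin] algebra_simps)
  then have "bounded_linear L"
    by (simp add: linear_conv_bounded_linear)
  then obtain y where y0: "y 0 = (B, 0)" and y: "\<And>t. (y has_vector_derivative L (y t)) (at t)"
    using linear_ode_exists by blast
  define X :: "'e oct_path" where "X = (\<lambda>k t. if k = a then A else 0)"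
  define Y :: "'e oct_path" where
    "Y = (\<lambda>k t. if k = p then fst (y t) else if k = q then snd (y t) else 0)"
  define Y' :: "'e oct_path" where
    "Y' = (\<lambda>k t. if k = p then - \<sigma> *\<^sub>R br A (snd (y t)) else if k = q then \<sigma> *\<^sub>R br A (fst (y t)) else 0)"
  have Y_deriv: "(Y k has_vector_derivative Y' k t) (at t)" for k t
  proof -
    have "((\<lambda>t. fst (y t)) has_vector_derivative fst (L (y t))) (at t)"
      "((\<lambda>t. snd (y t)) has_vector_derivative snd (L (y t))) (at t)"
      using bounded_linear.has_vector_derivative[OF bounded_linear_fst y]
        bounded_linear.has_vector_derivative[OF bounded_linear_snd y] by auto
    then show ?thesis
      unfolding Y_def Y'_def L_def by (auto simp: case_prod_beta)
  qed
  have ycont: "continuous_on {0..1} y"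
    by (intro continuous_at_imp_continuous_on ballI has_vector_derivative_continuous[OF y])
  have Y'_cont: "continuous_on {0..1} (Y' k)" for k
    unfolding Y'_def
    by (cases "k = p"; cases "k = q")
      (auto intro!: continuous_intros bounded_linear.continuous_on[OF blin] ycont)
  have ddtY: "ddt (Y k) t = Y' k t" if "t \<in> {0..1}" for k t
    using ddt_eqI[OF Y_deriv that] .
  have ddtX: "ddt (X k) t = 0" if "t \<in> {0..1}" for k t
    unfolding X_def by (rule ddt_eqI[OF has_vector_derivative_const that])
  have YV: "Y \<in> V_space"
    unfolding V_space_def C1_unit_def
    using Y'_cont has_vector_derivative_at_within[OF Y_deriv] by fast
  have XV: "X \<in> V_space"
    unfolding V_space_def C1_unit_def X_def
    by (auto intro!: exI[of _ "\<lambda>_. 0"])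
  have X0: "X 0 t = 0" and Y0: "Y 0 t = 0" for t
    using idx by (auto simp: X_def Y_def)
  have XN: "X \<in> N_oct br"
  proof -
    \<comment> \<open>Both arguments are nonzero only for j = l = a, and there \<open>oct_f\<close>
      vanishes by antisymmetry.\<close>
    have zero: "oct_f k j l *\<^sub>R br (X j t) (X l t) = 0" for k j l t
      using oct_f_swap[of k a a] by (auto simp: X_def br0)
    have "(\<Sum>j=1..7. \<Sum>l=1..7. oct_f k j l *\<^sub>R br (X j t) (X l t)) = 0" for k t
      by (simp only: zero sum.neutral_const)
    then show ?thesis
      unfolding N_oct_def mem_Collect_eq using XV ddtX by (simp only: X0 br0) simp
  qed
  have cross: "(1/2) *\<^sub>R (\<Sum>j=1..7. \<Sum>l=1..7. oct_f k j l *\<^sub>R (br (X j t) (Z l t) + br (Z j t) (X l t))) =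
      (\<Sum>l=1..7. oct_f k a l *\<^sub>R br A (Z l t))" for k t Z
    using oct_sum_single_generator[OF lin skew idx(1), of k A "\<lambda>l. Z l t"] by (simp only: X_def)
  have YN: "Y \<in> tangent_N_oct br X"
  proof -
    have "ddt (Y k) t + (\<Sum>l=1..7. oct_f k a l *\<^sub>R br A (Y l t)) = 0"
      if "k \<in> {1..7}" "t \<in> {0..1}" for k t
    proof -
      have "(\<Sum>l=1..7. oct_f k a l *\<^sub>R br A (Y l t)) = (\<Sum>l\<in>{p, q}. oct_f k a l *\<^sub>R br A (Y l t))"
        using idx by (intro sum.mono_neutral_right) (auto simp: Y_def br0)
      also have "\<dots> = - Y' k t"
        using that dist by (auto simp: Y_def Y'_def fp fq)
      finally show ?thesis
        using ddtY that by simp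
    qed
    then show ?thesis
      unfolding tangent_N_oct_def cross using YV by (auto simp: X0 Y0 br0)
  qed
  \<comment> \<open>The gauge fixing equation is trivial here: \<open>X\<close> and \<open>Y\<close>
    have no nonzero component in common, and \<open>Y 0\<close> vanishes.\<close>
  have "ddt (Y 0) t + (\<Sum>k=0..7. br (X k t) (Y k t)) = 0" if "t \<in> {0..1}" for t
  proof -
    have "br (X k t) (Y k t) = 0" for k
      using dist by (auto simp: X_def Y_def br0)
    moreover have "Y' 0 t = 0"
      using idx by (auto simp: Y'_def)
    ultimately show ?thesis
      using ddtY[OF that] by simp
  qed
  with YN have YM: "Y \<in> tangent_M_oct br X"
    by (simp add: tangent_M_oct_def)
  have "cplx_struct i Y \<notin> tangent_N_oct br X"
  proof
    define Z where "Z = cplx_struct i Y"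
    assume "cplx_struct i Y \<in> tangent_N_oct br X"
    \<comment> \<open>Component \<open>s\<close> is tested at time 0. Its derivative term comes from
      \<open>Y q\<close> and its bracket term from \<open>Y p\<close> via \<open>Z r\<close>;
      together they are the multiple of \<open>br A B\<close> whose coefficient \<open>ne\<close>
      makes nonzero.\<close>
    then have *: "ddt (Z s) 0 + br (X 0 0) (Z s 0) + br (Z 0 0) (X s 0) +
        (\<Sum>l=1..7. oct_f s a l *\<^sub>R br A (Z l 0)) = 0"
      using idx(5) unfolding tangent_N_oct_def cross Z_def[symmetric] by auto
    have Xs: "X s t = 0" for t
      using dist by (simp add: X_def)
    have single: "(\<Sum>j=0..7. (if j = m then c else 0) *\<^sub>R Y j t) = c *\<^sub>R Y m t"
      if "m \<in> {1..7}" for m c t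
    proof -
      have "(\<Sum>j=0..7. (if j = m then c else 0) *\<^sub>R Y j t) = (\<Sum>j=0..7. if j = m then c *\<^sub>R Y m t else 0)"
        by (intro sum.cong) auto
      then show ?thesis
        using that by simp
    qed
    have Zs: "Z s = (\<lambda>t. \<tau> *\<^sub>R Y q t)"
      unfolding Z_def cplx_struct_def using idx cs by (simp add: single)
    have Zr: "Z r = (\<lambda>t. \<rho> *\<^sub>R Y p t)"
      unfolding Z_def cplx_struct_def using idx cr by (simp add: single)
    have "(\<Sum>l=1..7. oct_f s a l *\<^sub>R br A (Z l 0)) = (\<Sum>l\<in>{r}. oct_f s a l *\<^sub>R br A (Z l 0))"
      using idx by (intro sum.mono_neutral_right) (auto simp: fs)
    then have sum: "(\<Sum>l=1..7. oct_f s a l *\<^sub>R br A (Z l 0)) = (\<omega> * \<rho>) *\<^sub>R br A B"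
      using idx by (simp add: fs Zr Y_def y0 linear_cmul[OF lin])
    have "(Z s has_vector_derivative \<tau> *\<^sub>R Y' q 0) (at 0)"
      unfolding Zs by (rule bounded_linear.has_vector_derivative[OF bounded_linear_scaleR_right Y_deriv])
    then have "ddt (Z s) 0 = \<tau> *\<^sub>R Y' q 0"
      by (rule ddt_eqI) simp
    also have "\<dots> = (\<tau> * \<sigma>) *\<^sub>R br A B"
      using dist by (simp add: Y'_def y0)
    finally have "(\<tau> * \<sigma>) *\<^sub>R br A B + (\<omega> * \<rho>) *\<^sub>R br A B = 0"
      using * unfolding sum X0 Xs br0 by simp
    then have "(\<tau> * \<sigma> + \<omega> * \<rho>) *\<^sub>R br A B = 0"
      by (simp only: scaleR_add_left)
    with ne AB show False
      by (simp only: scaleR_eq_0_iff simp_thms)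
  qed
  then show ?thesis
    using XN YM by blast
qed

lemma cplx_struct_not_preserved:
  fixes br :: "'e::euclidean_space \<Rightarrow> 'e \<Rightarrow> 'e"
  assumes "\<And>u. linear (br u)" and "\<And>u v. br u v = - br v u"
    and "br A B \<noteq> 0" and "i \<in> {1..7}"
  shows "\<exists>X\<in>N_oct br. \<exists>Y\<in>tangent_M_oct br X. cplx_struct i Y \<notin> tangent_N_oct br X"
proof -
  have range1: "{1..7::nat} = {1, 2, 3, 4, 5, 6, 7}" and range0: "{0..7::nat} = {0, 1, 2, 3, 4, 5, 6, 7}"
    by auto
  \<comment> \<open>The parameters are instantiated below in the order a, p, q, r, s, \<sigma>,
    \<omega>, i, \<rho>, \<tau>. The choice is a = 2 for i = 1 and a = 1 otherwise; p = 4 for i up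
    to 3 and p = 2 otherwise, which lies outside the quaternion algebra of i and a. The quantity in
    \<open>ne\<close> is 2 or -2 every time.\<close>
  note aux = cplx_struct_not_preserved_aux[OF assms(1-3)]
  note eval = range1 range0 oct_coeff_def oct_f_def oct_f0_def
  from assms(4) consider "i = 1" | "i = 2" | "i = 3" | "i = 4" | "i = 5" | "i = 6" | "i = 7"
    unfolding range1 by blast
  then show ?thesis
  proof cases
    case 1
    show ?thesis
      unfolding 1
      by (rule aux[of 2 4 6 5 7 "- 1" "- 1" 1 1 1]) (auto simp: eval)
  next
    case 2
    show ?thesis
      unfolding 2
      by (rule aux[of 1 4 5 6 7 "- 1" 1 2 1 "- 1"]) (auto simp: eval)
  next
    case 3
    show ?thesis
      unfolding 3
      by (rule aux[of 1 4 5 7 6 "- 1" "- 1" 3 "- 1" "- 1"]) (auto simp: eval)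
  next
    case 4
    show ?thesis
      unfolding 4
      by (rule aux[of 1 2 3 6 7 "- 1" 1 4 "- 1" 1]) (auto simp: eval)
  next
    case 5
    show ?thesis
      unfolding 5
      by (rule aux[of 1 2 3 7 6 "- 1" "- 1" 5 1 1]) (auto simp: eval)
  next
    case 6
    show ?thesis
      unfolding 6
      by (rule aux[of 1 2 3 4 5 "- 1" 1 6 1 "- 1"]) (auto simp: eval)
  next
    case 7
    show ?thesis
      unfolding 7
      by (rule aux[of 1 2 3 5 4 "- 1" "- 1" 7 "- 1" "- 1"]) (auto simp: eval)
  qed
qed

theorem proposition4p4:
  fixes G :: "('g, 'm) monoid_scheme"
    and T :: "'g topology"
    and \<A> :: "('g, 'e::euclidean_space) chart set"
    and c :: "('g, 'e) chart"
    and i :: nat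
  assumes "lie_group G T \<A>"
    and "compact_space T"
    and "nonabelian_lie_group G T"
    and "c \<in> \<A>" and "\<one>\<^bsub>G\<^esub> \<in> fst c"
    and "i \<in> {1..7}"
  shows "\<not> (\<forall>X \<in> N_oct (lie_bracket G c).
               cplx_struct i ` tangent_N_oct (lie_bracket G c) X \<subseteq> tangent_N_oct (lie_bracket G c) X)
       \<and> \<not> (\<forall>X \<in> N_oct (lie_bracket G c).
               cplx_struct i ` tangent_M_oct (lie_bracket G c) X \<subseteq> tangent_M_oct (lie_bracket G c) X)"
proof -
  interpret lie_group G T \<A> by (rule assms(1))
  obtain U \<phi> where c: "c = (U, \<phi>)" by (cases c)
  interpret lie_group_chart G T \<A> U \<phi>
    using assms(4,5) by unfold_locales (auto simp: c)
  obtain u v where uv: "lie_bracket G c u v \<noteq> 0"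
    using lie_bracket_nonzero[OF assms(3)] by (auto simp: c)
  obtain X Y where XY: "X \<in> N_oct (lie_bracket G c)" "Y \<in> tangent_M_oct (lie_bracket G c) X"
    "cplx_struct i Y \<notin> tangent_N_oct (lie_bracket G c) X"
    using cplx_struct_not_preserved[of "lie_bracket G c", OF _ _ uv assms(6)]
      linear_lie_bracket lie_bracket_skew unfolding c by blast
  \<comment> \<open>This inclusion is used twice: it puts \<open>Y\<close> into the larger space for
    the first claim, and it excludes the image of \<open>Y\<close> from the smaller one for the
    second.\<close>
  have "tangent_M_oct (lie_bracket G c) X \<subseteq> tangent_N_oct (lie_bracket G c) X"
    by (auto simp: tangent_M_oct_def)
  with XY show ?thesis by blast
qed

end
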